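(* Let $(X,S)$ be an infinite minimal subshift on a finite alphabet $\mathcal A$ such that $$K_1=\liminf_{n\to+\infty}\big(p_X(n+1)-p_X(n)\big)$$ is finite. Then $(X,S)$ has finite topological rank, and its topological rank is at most $$(1+|\mathcal A|^2K_1^2)^{2(K_1+2)}.$$ In particular, every infinite minimal subshift with non-superlinear complexity, i.e. $\liminf_{n\to+\infty}p_X(n)/n<+\infty$, has finite topological rank.
   Context: $S$ is the shift map; $p_X(n)$ is the number of words of length $n$ occurring in elements of $X$. Topological rank. Let $(X,T)$ be a minimal Cantor system (minimal homeomorphism of a Cantor set). A clopen Kakutani-Rohlin (CKR) partition of $X$ is a partition $\mathcal T=\{T^{-j}B(k):1\le k\le d,\ 0\le j<h(k)\}$ of $X$, where $B(1),\dots,B(d)$ are clopen, $h(k)\geq 1$ and $\bigcup_k T^{-h(k)}B(k)=\bigcup_k B(k)$; its base is $B(\mathcal T)=\bigcup_k B(k)$, and it has $d$ towers $\mathcal T(k)=\{T^{-j}B(k):0\le j<h(k)\}$. A sequence $(\mathcal T_n)_{n\ge0}$ of CKR partitions, $\mathcal T_n=\{T^{-j}B_n(k):1\le k\le d_n,0\le j<h_n(k)\}$, $\mathcal T_0=\{X\}$, is nested if for all $n$: $B(\mathcal T_{n+1})\subseteq B(\mathcal T_n)$; $\mathcal T_{n+1}$ refines $\mathcal T_n$; $\bigcap_n B(\mathcal T_n)$ is a single point; and the partitions $\mathcal T_n$ span the topology of $X$. It is primitive if for every $n\ge1$ there is $N>n$ such that every tower of $\mathcal T_N$ crosses every tower of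 $\mathcal T_n$ (i.e. the points of each $T^{-(h_N(k)-1)}B_N(k)$, iterated by $T$ until reaching $B_N(k)$, completely cross all towers of $\mathcal T_n$). The system has finite topological rank if it admits a primitive nested sequence of CKR partitions with $d_n\le d$ for all $n$, for some $d$ (equivalently, a Bratteli-Vershik representation with at most $d$ vertices per level); the minimum such $d$ is its topological rank. *)

theory Defs
  imports "HOL-Analysis.Analysis"
begin

section \<open>Two-sided subshifts\<close>

definition shift :: "(int \<Rightarrow> 'a) \<Rightarrow> int \<Rightarrow> 'a" where
  "shift x = (\<lambda>i. x (i + 1))"

definition full_shift :: "'a set \<Rightarrow> (int \<Rightarrow> 'a) topology" where
  "full_shift A = product_topology (\<lambda>_. discrete_topology A) UNIV"

definition subshift :: "'a set \<Rightarrow> (int \<Rightarrow> 'a) set \<Rightarrow> bool" where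
  "subshift A X \<longleftrightarrow> finite A \<and> closedin (full_shift A) X \<and> shift ` X = X"

definition minimal_map :: "'x topology \<Rightarrow> ('x \<Rightarrow> 'x) \<Rightarrow> bool" where
  "minimal_map M T \<longleftrightarrow> topspace M \<noteq> {} \<and>
     (\<forall>C. closedin M C \<and> T ` C = C \<longrightarrow> C = {} \<or> C = topspace M)"

definition minimal_subshift :: "'a set \<Rightarrow> (int \<Rightarrow> 'a) set \<Rightarrow> bool" where
  "minimal_subshift A X \<longleftrightarrow>
     subshift A X \<and> minimal_map (subtopology (full_shift A) X) shift"

definition words :: "(int \<Rightarrow> 'a) set \<Rightarrow> nat \<Rightarrow> 'a list set" where
  "words X n = {map (\<lambda>j. x (i + int j)) [0..<n] | x i. x \<in> X}"

definition complexity :: "(int \<Rightarrow> 'a) set \<Rightarrow> nat \<Rightarrow> nat" where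
  "complexity X n = card (words X n)"


section \<open>Clopen Kakutani-Rohlin partitions and topological rank\<close>

text \<open>
  The notions below are meant for a minimal homeomorphism \<open>T\<close> of a Cantor space \<open>M\<close>.
  Towers are indexed by \<open>1, \<dots>, num_towers P\<close>; the values of \<open>base P\<close> and \<open>height P\<close>
  outside this range are irrelevant.  The levels of a tower are preimages of its base, so the
  base is the last level visited by a point moving under \<open>T\<close>.
\<close>

record 'x towers =
  num_towers :: nat
  base :: "nat \<Rightarrow> 'x set"
  height :: "nat \<Rightarrow> nat"

definition level :: "'x topology \<Rightarrow> ('x \<Rightarrow> 'x) \<Rightarrow> 'x towers \<Rightarrow> nat \<Rightarrow> nat \<Rightarrow> 'x set" where
  "level M T P k j = {x \<in> topspace M. (T ^^ j) x \<in> base P k}"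

definition level_indices :: "'x towers \<Rightarrow> (nat \<times> nat) set" where
  "level_indices P = (SIGMA k:{1..num_towers P}. {..<height P k})"

definition levels :: "'x topology \<Rightarrow> ('x \<Rightarrow> 'x) \<Rightarrow> 'x towers \<Rightarrow> 'x set set" where
  "levels M T P = (\<lambda>(k, j). level M T P k j) ` level_indices P"

definition full_base :: "'x towers \<Rightarrow> 'x set" where
  "full_base P = (\<Union>k\<in>{1..num_towers P}. base P k)"

text \<open>
  Injectivity says that different indices give different (hence disjoint) levels, which
  \<^const>\<open>partition_on\<close>, being about the set of levels, does not see.
\<close>

definition ckr_partition :: "'x topology \<Rightarrow> ('x \<Rightarrow> 'x) \<Rightarrow> 'x towers \<Rightarrow> bool" where
  "ckr_partition M T P \<longleftrightarrow>
     (\<forall>k\<in>{1..num_towers P}. openin M (base P k) \<and> closedin M (base P k) \<and> height P k \<ge> 1) \<and>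
     inj_on (\<lambda>(k, j). level M T P k j) (level_indices P) \<and>
     partition_on (topspace M) (levels M T P) \<and>
     (\<Union>k\<in>{1..num_towers P}. level M T P k (height P k)) = full_base P"

definition nested_ckr :: "'x topology \<Rightarrow> ('x \<Rightarrow> 'x) \<Rightarrow> (nat \<Rightarrow> 'x towers) \<Rightarrow> bool" where
  "nested_ckr M T P \<longleftrightarrow>
     (\<forall>n. ckr_partition M T (P n)) \<and>
     levels M T (P 0) = {topspace M} \<and>
     (\<forall>n. full_base (P (Suc n)) \<subseteq> full_base (P n)) \<and>
     (\<forall>n. \<forall>U\<in>levels M T (P (Suc n)). \<exists>V\<in>levels M T (P n). U \<subseteq> V) \<and>
     (\<exists>x. (\<Inter>n. full_base (P n)) = {x}) \<and>
     topology_generated_by (\<Union>n. levels M T (P n)) = M"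

text \<open>
  Tower \<open>k\<close> of \<open>Q\<close> crosses tower \<open>l\<close> of \<open>P\<close>: every point of the level of \<open>k\<close> farthest from
  the base meets, before leaving tower \<open>k\<close>, all levels of \<open>l\<close> consecutively, ending in the
  base of \<open>l\<close>.
\<close>

definition crosses ::
    "'x topology \<Rightarrow> ('x \<Rightarrow> 'x) \<Rightarrow> 'x towers \<Rightarrow> nat \<Rightarrow> 'x towers \<Rightarrow> nat \<Rightarrow> bool" where
  "crosses M T Q k P l \<longleftrightarrow>
     (\<forall>x\<in>level M T Q k (height Q k - 1).
        \<exists>i. i + height P l \<le> height Q k \<and>
            (\<forall>j<height P l. (T ^^ (i + j)) x \<in> level M T P l (height P l - 1 - j)))"

definition primitive_ckr :: "'x topology \<Rightarrow> ('x \<Rightarrow> 'x) \<Rightarrow> (nat \<Rightarrow> 'x towers) \<Rightarrow> bool" where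
  "primitive_ckr M T P \<longleftrightarrow>
     (\<forall>n\<ge>1. \<exists>N>n. \<forall>k\<in>{1..num_towers (P N)}. \<forall>l\<in>{1..num_towers (P n)}.
        crosses M T (P N) k (P n) l)"

definition rank_at_most :: "'x topology \<Rightarrow> ('x \<Rightarrow> 'x) \<Rightarrow> nat \<Rightarrow> bool" where
  "rank_at_most M T d \<longleftrightarrow>
     (\<exists>P. nested_ckr M T P \<and> primitive_ckr M T P \<and> (\<forall>n. num_towers (P n) \<le> d))"

definition finite_topological_rank :: "'x topology \<Rightarrow> ('x \<Rightarrow> 'x) \<Rightarrow> bool" where
  "finite_topological_rank M T \<longleftrightarrow> (\<exists>d. rank_at_most M T d)"

definition topological_rank :: "'x topology \<Rightarrow> ('x \<Rightarrow> 'x) \<Rightarrow> nat" where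
  "topological_rank M T = (LEAST d. rank_at_most M T d)"

end

theory Submission
  imports Defs
begin

text \<open>
  Let \<open>z \<in> X\<close> have a past all of whose suffixes are right special, and let \<open>u\<close> be a long central
  factor of \<open>z\<close>.  Pick \<open>N\<close> much longer than \<open>u\<close> with \<open>p (N + 1) - p N \<le> K\<close>, so that at most \<open>K\<close> words of
  length \<open>N\<close> are right special.  In a point of \<open>X\<close>, mark those occurrences of \<open>u\<close> that are the first
  to be completed since the last visit to a right special word of length \<open>N\<close>.  The word between two
  consecutive marks is determined by the right special word visited last before the first mark
  together with the letters that follow the subsequent right special words: elsewhere the past forces
  the next letter.  Between the two marks no right special word occurs twice, because \<open>u\<close> would be
  avoided for the whole time between two occurrences, so they would be close to each other, which
  aperiodicity excludes when \<open>N\<close> is large.  Hence there are at most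
  \<open>K \<cdot> (1 + |A| + \<dots> + |A|\<^sup>K\<^sup>+\<^sup>1)\<close> such words.  The set of marked points is a clopen
  neighbourhood of \<open>z\<close> inside the cylinder of \<open>u\<close>, and return words to it, extended on both sides,
  index the towers of a Kakutani-Rohlin partition; longer and longer \<open>u\<close> give a nested sequence.
\<close>

subsection \<open>Compactness, minimality and aperiodicity\<close>

definition sh :: "int \<Rightarrow> (int \<Rightarrow> 'a) \<Rightarrow> int \<Rightarrow> 'a" where
  "sh i x = (\<lambda>k. x (k + i))"

lemma sh_apply: "sh i x k = x (k + i)"
  by (simp add: sh_def)

lemma sh_sh [simp]: "sh i (sh j x) = sh (i + j) x"
  by (simp add: sh_def algebra_simps)

lemma sh_0 [simp]: "sh 0 x = x"
  by (simp add: sh_def)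

lemma shift_eq_sh: "shift = sh 1"
  by (simp add: fun_eq_iff shift_def sh_def)

lemma shift_funpow: "(shift ^^ j) x = sh (int j) x"
  by (induction j) (simp_all add: shift_eq_sh)

text \<open>The window is half-open, so \<open>agree (- int N) 0 x y\<close> compares exactly the
  last \<open>N\<close> letters before the origin and leaves the letter at \<open>0\<close>
  free.\<close>

definition agree :: "int \<Rightarrow> int \<Rightarrow> (int \<Rightarrow> 'a) \<Rightarrow> (int \<Rightarrow> 'a) \<Rightarrow> bool" where
  "agree a b x y \<longleftrightarrow> (\<forall>k. a \<le> k \<and> k < b \<longrightarrow> x k = y k)"

lemma agreeD: "agree a b x y \<Longrightarrow> a \<le> k \<Longrightarrow> k < b \<Longrightarrow> x k = y k"
  by (simp add: agree_def)

lemma agree_sym: "agree a b x y \<Longrightarrow> agree a b y x"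
  by (simp add: agree_def)

lemma agree_trans: "agree a b x y \<Longrightarrow> agree a b y w \<Longrightarrow> agree a b x w"
  by (simp add: agree_def)

lemma agree_mono: "agree a b x y \<Longrightarrow> a \<le> c \<Longrightarrow> d \<le> b \<Longrightarrow> agree c d x y"
  by (simp add: agree_def)

lemma agree_sh_iff: "agree a b (sh i x) (sh i y) \<longleftrightarrow> agree (a + i) (b + i) x y"
proof
  assume *: "agree a b (sh i x) (sh i y)"
  show "agree (a + i) (b + i) x y"
    unfolding agree_def
  proof safe
    fix k assume "a + i \<le> k" "k < b + i"
    then show "x k = y k"
      using agreeD[OF *, of "k - i"] by (simp add: sh_apply)
  qed
qed (simp add: agree_def sh_apply)

lemma agree_sh: "agree c d x y \<Longrightarrow> c \<le> a + i \<Longrightarrow> b + i \<le> d \<Longrightarrow> agree a b (sh i x) (sh i y)"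
  unfolding agree_sh_iff by (rule agree_mono)

definition factor :: "(int \<Rightarrow> 'a) \<Rightarrow> int \<Rightarrow> nat \<Rightarrow> 'a list" where
  "factor x i n = map (\<lambda>j. x (i + int j)) [0..<n]"

lemma length_factor [simp]: "length (factor x i n) = n"
  by (simp add: factor_def)

lemma factor_sh: "factor (sh i x) j n = factor x (j + i) n"
  by (simp add: factor_def sh_def algebra_simps)

lemma factor_eq_iff: "factor x i n = factor y i n \<longleftrightarrow> agree i (i + int n) x y"
proof
  assume *: "factor x i n = factor y i n"
  show "agree i (i + int n) x y"
    unfolding agree_def
  proof safe
    fix k assume k: "i \<le> k" "k < i + int n"
    then obtain j where j: "k = i + int j" "j < n" by (metis add_less_cancel_left of_nat_less_iff zle_iff_zadd)
    moreover have "factor x i n ! j = factor y i n ! j" using * by simp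
    ultimately show "x k = y k" by (simp add: factor_def)
  qed
qed (simp add: factor_def agree_def)

lemma words_eq_factors: "words X n = {factor x i n | x i. x \<in> X}"
  by (simp add: words_def factor_def)

section \<open>Topology and minimality of the subshift\<close>

locale infinite_minimal_subshift =
  fixes A :: "'a set" and X :: "(int \<Rightarrow> 'a) set"
  assumes minimal: "minimal_subshift A X" and inf: "infinite X"
begin

abbreviation M :: "(int \<Rightarrow> 'a) topology" where
  "M \<equiv> subtopology (full_shift A) X"

lemma finite_A: "finite A"
  using minimal by (simp add: minimal_subshift_def subshift_def)

lemma X_closed: "closedin (full_shift A) X"
  using minimal by (simp add: minimal_subshift_def subshift_def)

lemma X_values: "x \<in> X \<Longrightarrow> x k \<in> A"
  using closedin_subset[OF X_closed] by (auto simp: full_shift_def)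

lemma topspace_full_shift_Int [simp]: "topspace (full_shift A) \<inter> X = X"
  using closedin_subset[OF X_closed] by blast

lemma topspace_M: "topspace M = X"
  by simp

lemma compact_M: "compact_space M"
proof -
  have "compact_space (full_shift A)"
    by (simp add: full_shift_def compact_space_product_topology compact_space_discrete_topology
        finite_A)
  then show ?thesis
    using X_closed closedin_compact_space compact_space_subtopology by blast
qed

lemma Hausdorff_M: "Hausdorff_space M"
  by (simp add: full_shift_def Hausdorff_space_subtopology Hausdorff_space_product_topology)

lemma sh_nat_in_iff: "sh (int n) x \<in> X \<longleftrightarrow> x \<in> X"
proof (induction n arbitrary: x)
  case (Suc n)
  have inj: "inj (shift :: (int \<Rightarrow> 'a) \<Rightarrow> _)"
    by (rule inj_on_inverseI[where g = "sh (-1)"]) (simp add: shift_eq_sh)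
  have "sh (int (Suc n)) x = sh (int n) (shift x)"
    by (simp add: shift_eq_sh algebra_simps)
  moreover have "shift x \<in> X \<longleftrightarrow> x \<in> X"
    using inj minimal unfolding minimal_subshift_def subshift_def by (metis inj_image_mem_iff)
  ultimately show ?case using Suc by simp
qed simp

lemma sh_in_iff [simp]: "sh i x \<in> X \<longleftrightarrow> x \<in> X"
proof (cases "i \<ge> 0")
  case True
  then show ?thesis using sh_nat_in_iff[of "nat i" x] by simp
next
  case False
  then show ?thesis using sh_nat_in_iff[of "nat (-i)" "sh i x"] by simp
qed

text \<open>A basic open box restricts only finitely many coordinates, and one symmetric window
  covers them all; conversely, a window is cut out by a box with singleton factors.\<close>

lemma openin_M_iff:
  "openin M U \<longleftrightarrow> U \<subseteq> X \<and> (\<forall>x\<in>U. \<exists>w. \<forall>y\<in>X. agree (- w) w x y \<longrightarrow> y \<in> U)"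
proof safe
  fix x assume "openin M U" "x \<in> U"
  then show "x \<in> X" using openin_subset by fastforce
next
  fix x assume U: "openin M U" and x: "x \<in> U"
  obtain V where V: "openin (full_shift A) V" "U = V \<inter> X"
    using U by (auto simp: openin_subtopology)
  then obtain B where B: "finite {i. B i \<noteq> A}" "x \<in> Pi\<^sub>E UNIV B" "Pi\<^sub>E UNIV B \<subseteq> V"
    using x by (auto simp: full_shift_def openin_product_topology_alt)
  \<comment> \<open>The element \<open>0\<close> keeps \<open>Max\<close> meaningful when no
    coordinate is restricted; \<open>+ 1\<close> puts the largest restricted coordinate inside the
    half-open window.\<close>
  define w where "w = Max (abs ` {i. B i \<noteq> A} \<union> {0}) + 1"
  have w: "\<bar>i\<bar> < w" if "B i \<noteq> A" for i
    using that B(1) unfolding w_def by (simp add: zle_add1_eq_le)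
  have "y \<in> U" if y: "y \<in> X" "agree (- w) w x y" for y
  proof -
    have "y i \<in> B i" for i
    proof (cases "B i = A")
      case True
      then show ?thesis using X_values y by simp
    next
      case False
      then have "x i = y i" using w[of i] agreeD[OF y(2), of i] by auto
      then show ?thesis using B(2) by (metis PiE_mem UNIV_I)
    qed
    then show ?thesis using B(3) V(2) y by (auto simp: PiE_def)
  qed
  then show "\<exists>w. \<forall>y\<in>X. agree (- w) w x y \<longrightarrow> y \<in> U" by blast
next
  assume U: "U \<subseteq> X" "\<forall>x\<in>U. \<exists>w. \<forall>y\<in>X. agree (- w) w x y \<longrightarrow> y \<in> U"
  show "openin M U"
  proof (subst openin_subopen, safe)
    fix x assume x: "x \<in> U"
    then obtain w where w: "\<forall>y\<in>X. agree (- w) w x y \<longrightarrow> y \<in> U" using U by blast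
    define B where "B = (\<lambda>i. if - w \<le> i \<and> i < w then {x i} else A)"
    have xi: "x i \<in> A" for i using X_values U(1) x by blast
    have "{i. B i \<noteq> A} \<subseteq> {-w..<w}" by (auto simp: B_def)
    then have "openin (full_shift A) (Pi\<^sub>E UNIV B)"
      using finite_subset by (fastforce simp: full_shift_def openin_PiE_gen B_def xi)
    then have "openin M (X \<inter> Pi\<^sub>E UNIV B)"
      by (auto simp: openin_subtopology)
    moreover have "x \<in> X \<inter> Pi\<^sub>E UNIV B"
      using x U(1) xi by (auto simp: B_def)
    moreover have "X \<inter> Pi\<^sub>E UNIV B \<subseteq> U"
    proof
      fix y assume y: "y \<in> X \<inter> Pi\<^sub>E UNIV B"
      have "agree (- w) w x y"
        unfolding agree_def
      proof safe
        fix k assume "- w \<le> k" "k < w"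
        moreover have "y k \<in> B k" using y by (auto simp: PiE_def)
        ultimately show "x k = y k" by (simp add: B_def)
      qed
      then show "y \<in> U" using w y by blast
    qed
    ultimately show "\<exists>T. openin M T \<and> x \<in> T \<and> T \<subseteq> U" by blast
  qed
qed

text \<open>Clopen sets are handled through an explicit window; its width later tells how long the
  words of the next stage must be.\<close>

definition determined :: "int \<Rightarrow> (int \<Rightarrow> 'a) set \<Rightarrow> bool" where
  "determined w U \<longleftrightarrow> (\<forall>x\<in>X. \<forall>y\<in>X. agree (- w) w x y \<longrightarrow> x \<in> U \<longrightarrow> y \<in> U)"

lemma determinedI:
  "(\<And>x y. x \<in> X \<Longrightarrow> y \<in> X \<Longrightarrow> agree (- w) w x y \<Longrightarrow> x \<in> U \<Longrightarrow> y \<in> U) \<Longrightarrow> determined w U"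
  by (simp add: determined_def)

lemma determined_mono: "determined w U \<Longrightarrow> w \<le> v \<Longrightarrow> determined v U"
  unfolding determined_def using agree_mono[of "- v" v _ _ "- w" w] by auto

lemma determined_sh:
  assumes "determined w U" "x \<in> X" "y \<in> X" "agree a b x y" "a \<le> i - w" "i + w \<le> b"
  shows "sh i x \<in> U \<longleftrightarrow> sh i y \<in> U"
proof -
  have "agree (- w) w (sh i x) (sh i y)"
    using assms by (intro agree_sh[OF assms(4)]) auto
  then show ?thesis
    using assms agree_sym unfolding determined_def by (metis sh_in_iff)
qed

lemma determined_openin: "U \<subseteq> X \<Longrightarrow> determined w U \<Longrightarrow> openin M U"
  unfolding openin_M_iff determined_def by blast

lemma determined_closedin:
  assumes "U \<subseteq> X" "determined w U"
  shows "closedin M U"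
proof -
  have "determined w (X - U)"
    using assms(2) unfolding determined_def by (auto dest: agree_sym)
  then show ?thesis
    using assms determined_openin[of "X - U" w] by (simp add: closedin_def)
qed

lemma invariant_closed:
  assumes "closedin M C" "\<And>i x. x \<in> C \<Longrightarrow> sh i x \<in> C" "C \<noteq> {}"
  shows "C = X"
proof -
  have "shift ` C = C"
  proof
    show "shift ` C \<subseteq> C" using assms(2) by (auto simp: shift_eq_sh)
    show "C \<subseteq> shift ` C"
    proof
      fix x assume "x \<in> C"
      then have "sh (-1) x \<in> C" by (rule assms(2))
      moreover have "x = shift (sh (-1) x)" by (simp add: shift_eq_sh)
      ultimately show "x \<in> shift ` C" by blast
    qed
  qed
  then show ?thesis
    using minimal assms(1,3) unfolding minimal_subshift_def minimal_map_def by (metis topspace_M)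
qed

lemma nested_nonempty:
  assumes "\<And>n. C n \<subseteq> X" "\<And>n. determined (w n) (C n)" "\<And>n. C n \<noteq> {}" "decseq C"
  shows "\<exists>x. \<forall>n::nat. x \<in> C n"
proof -
  have "(\<Inter>n. C n) \<noteq> {}"
    using assms by (intro compact_space_imp_nest[OF compact_M]) (auto intro: determined_closedin)
  then show ?thesis by blast
qed

text \<open>If visits to \<open>U\<close> could be delayed arbitrarily long, compactness would yield
  a point whose whole orbit avoids \<open>U\<close>. Such points form a closed invariant set, which
  minimality makes equal to \<open>X\<close>, although \<open>U\<close> is nonempty.\<close>

lemma syndetic:
  assumes U: "U \<subseteq> X" "determined w U" "U \<noteq> {}"
  shows "\<exists>R::nat. \<forall>x\<in>X. \<exists>i\<le>R. sh (int i) x \<in> U"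
proof (rule ccontr)
  assume neg: "\<not> ?thesis"
  define C where "C n = {x \<in> X. \<forall>i. \<bar>i\<bar> \<le> int n \<longrightarrow> sh i x \<notin> U}" for n :: nat
  have det: "determined (w + int n) (C n)" for n
  proof (rule determinedI)
    fix x y assume *: "x \<in> X" "y \<in> X" "agree (- (w + int n)) (w + int n) x y" "x \<in> C n"
    have "sh i x \<in> U \<longleftrightarrow> sh i y \<in> U" if "\<bar>i\<bar> \<le> int n" for i
      using that by (intro determined_sh[OF U(2) *(1-3)]) auto
    then show "y \<in> C n" using * by (auto simp: C_def)
  qed
  have ne: "C n \<noteq> {}" for n
  proof -
    obtain x where x: "x \<in> X" "\<And>i. i \<le> 2 * n \<Longrightarrow> sh (int i) x \<notin> U"
      using neg by (metis mult_2)
    \<comment> \<open>A stretch of \<open>2 * n\<close> steps free of \<open>U\<close> becomes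
      two-sided when recentred at its midpoint.\<close>
    have "sh (int n) x \<in> C n"
    proof -
      have "sh (i + int n) x \<notin> U" if "\<bar>i\<bar> \<le> int n" for i
      proof -
        have "nat (i + int n) \<le> 2 * n" "int (nat (i + int n)) = i + int n" using that by linarith+
        then show ?thesis using x(2) by metis
      qed
      then show ?thesis using x(1) by (simp add: C_def)
    qed
    then show ?thesis by blast
  qed
  have "decseq C" by (auto simp: decseq_def C_def)
  have "\<exists>x. \<forall>n. x \<in> C n"
    by (rule nested_nonempty[OF _ det ne \<open>decseq C\<close>]) (auto simp: C_def)
  then obtain x where x: "\<And>n. x \<in> C n" by blast
  define Z where "Z = (\<Inter>n. C n)"
  have Z: "Z = {x \<in> X. \<forall>i. sh i x \<notin> U}"
  proof -
    have "sh i y \<notin> U" if "y \<in> Z" for i y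
      using that unfolding Z_def C_def by (auto dest: spec[of _ "nat \<bar>i\<bar>"])
    then show ?thesis by (auto simp: Z_def C_def)
  qed
  have "closedin M Z"
    unfolding Z_def using det C_def by (intro closedin_INT determined_closedin) auto
  moreover have "x \<in> Z" using x by (simp add: Z_def)
  ultimately have "Z = X"
    by (intro invariant_closed) (auto simp: Z)
  then show False using Z U(1,3) by (metis (mono_tags, lifting) all_not_in_conv mem_Collect_eq sh_0 subsetD)
qed

text \<open>The orbit of a periodic point is finite, hence closed in a Hausdorff space, hence all of
  the infinite set \<open>X\<close>.\<close>

lemma not_periodic:
  assumes "x \<in> X" "p > 0"
  shows "sh p x \<noteq> x"
proof
  assume per: "sh p x = x"
  have perp: "sh (int k * p) x = x" for k
  proof (induction k)
    case (Suc k)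
    have "sh (int (Suc k) * p) x = sh p (sh (int k * p) x)" by (simp add: algebra_simps)
    then show ?case using Suc per by simp
  qed simp
  have perm: "sh (k * p) x = x" for k
  proof (cases "k \<ge> 0")
    case True
    then show ?thesis using perp[of "nat k"] by simp
  next
    case False
    then have "sh (- k * p) x = x" using perp[of "nat (-k)"] by simp
    then have "sh (k * p) (sh (- k * p) x) = sh (k * p) x" by simp
    then show ?thesis by simp
  qed
  define C where "C = range (\<lambda>i. sh i x)"
  have "C \<subseteq> (\<lambda>i. sh i x) ` {0..<p}"
  proof -
    have "sh i x = sh (i mod p) x" for i
    proof -
      have "sh i x = sh (i mod p) (sh (i div p * p) x)" by simp
      then show ?thesis by (simp only: perm)
    qed
    moreover have "i mod p \<in> {0..<p}" for i using assms(2) by simp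
    ultimately show ?thesis unfolding C_def by blast
  qed
  then have fin: "finite C" using finite_subset by blast
  have "C \<subseteq> X" using assms(1) by (auto simp: C_def)
  then have "closedin M C"
    using fin Hausdorff_M by (intro compactin_imp_closedin finite_imp_compactin) simp_all
  then have "C = X"
    by (rule invariant_closed) (auto simp: C_def)
  then show False using fin inf by simp
qed

text \<open>Ever longer words of period \<open>p\<close> would by compactness produce a point of
  period \<open>p\<close>, which is excluded. The induction deals with one period at a time.\<close>

lemma no_short_repetition:
  "\<exists>L::nat. \<forall>x\<in>X. \<forall>p::nat. 1 \<le> p \<and> p \<le> R \<longrightarrow> \<not> agree (- int L) 0 x (sh (int p) x)"
proof (induction R)
  case (Suc R)
  then obtain L1 where L1: "\<forall>x\<in>X. \<forall>p::nat. 1 \<le> p \<and> p \<le> R \<longrightarrow>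
      \<not> agree (- int L1) 0 x (sh (int p) x)" by blast
  define p where "p = int (Suc R)"
  define C where "C n = {x \<in> X. agree (- int n) (int n) x (sh p x)}" for n
  have "\<exists>n. C n = {}"
  proof (rule ccontr)
    assume ne: "\<not> (\<exists>n. C n = {})"
    have det: "determined (int n + p) (C n)" for n
    proof (rule determinedI)
      fix x y assume *: "x \<in> X" "y \<in> X" "agree (- (int n + p)) (int n + p) x y" "x \<in> C n"
      have "agree (- int n) (int n) y x" "agree (- int n) (int n) (sh p x) (sh p y)"
        using *(3) by (auto intro!: agree_sh intro: agree_sym agree_mono simp: p_def)
      then show "y \<in> C n" using * by (auto simp: C_def intro: agree_trans)
    qed
    have "decseq C" by (auto simp: decseq_def C_def agree_def)
    have "\<exists>x. \<forall>n. x \<in> C n"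
      using ne by (intro nested_nonempty[OF _ det _ \<open>decseq C\<close>]) (auto simp: C_def)
    then obtain x where x: "\<And>n. x \<in> C n" by blast
    have "sh p x k = x k" for k
    proof -
      have "agree (- int (nat \<bar>k\<bar> + 1)) (int (nat \<bar>k\<bar> + 1)) x (sh p x)"
        using x[of "nat \<bar>k\<bar> + 1"] unfolding C_def by blast
      then have "x k = sh p x k" by (rule agreeD) linarith+
      then show ?thesis by simp
    qed
    then have "sh p x = x" by blast
    then show False using not_periodic[of x p] x[of 0] by (auto simp: C_def p_def)
  qed
  then obtain n where n: "C n = {}" by blast
  \<comment> \<open>The statement looks only at the past while \<open>C n\<close> looks both ways,
    so a past of length \<open>2 * n\<close> is recentred at \<open>- n\<close>.\<close>
  have "\<not> agree (- int (max L1 (2 * n))) 0 x (sh (int q) x)"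
    if "x \<in> X" "1 \<le> q" "q \<le> Suc R" for x q
  proof
    assume a: "agree (- int (max L1 (2 * n))) 0 x (sh (int q) x)"
    show False
    proof (cases "q \<le> R")
      case True
      moreover have "agree (- int L1) 0 x (sh (int q) x)" by (rule agree_mono[OF a]) linarith+
      ultimately show ?thesis using L1 that by blast
    next
      case False
      then have "q = Suc R" using that by simp
      then have "agree (- int n) (int n) (sh (- int n) x) (sh (- int n) (sh p x))"
        unfolding p_def by (intro agree_sh[OF a[unfolded \<open>q = Suc R\<close>]]) linarith+
      moreover have "sh (- int n) (sh p x) = sh p (sh (- int n) x)" by (simp add: add.commute)
      ultimately have "sh (- int n) x \<in> C n" using that by (simp add: C_def)
      then show ?thesis using n by blast
    qed
  qed
  then show ?case by blast
qed auto

section \<open>Right special words\<close>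

text \<open>The points of \<open>special N\<close> are those whose last \<open>N\<close> letters before the origin form a right
  special word.\<close>

definition special :: "nat \<Rightarrow> (int \<Rightarrow> 'a) set" where
  "special N = {x \<in> X. \<exists>y\<in>X. agree (- int N) 0 x y \<and> x 0 \<noteq> y 0}"

lemma special_subset: "special N \<subseteq> X"
  by (auto simp: special_def)

text \<open>If \<open>x\<close> and \<open>y\<close> differ at \<open>0\<close>, then
  \<open>x\<close> itself is the witness for \<open>y\<close>; otherwise the witness for
  \<open>x\<close> serves for \<open>y\<close> too.\<close>

lemma special_past:
  assumes "x \<in> special N" "y \<in> X" "agree (- int N) 0 x y"
  shows "y \<in> special N"
proof -
  obtain v where v: "v \<in> X" "agree (- int N) 0 x v" "x 0 \<noteq> v 0" "x \<in> X"
    using assms(1) by (auto simp: special_def)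
  have yx: "agree (- int N) 0 y x" using assms(3) by (rule agree_sym)
  have yv: "agree (- int N) 0 y v" using yx v(2) by (rule agree_trans)
  show ?thesis
  proof (cases "y 0 = x 0")
    case True
    then show ?thesis using assms(2) v yv by (auto simp: special_def)
  next
    case False
    then show ?thesis using assms(2) v(4) yx by (auto simp: special_def)
  qed
qed

lemma determined_special: "determined (int N) (special N)"
proof (rule determinedI)
  fix x y assume *: "x \<in> X" "y \<in> X" "agree (- int N) (int N) x y" "x \<in> special N"
  show "y \<in> special N" by (rule special_past[OF *(4,2) agree_mono[OF *(3)]]) simp_all
qed

lemma nonspecial_step:
  assumes "x \<in> X" "y \<in> X" "agree (k - int N) k x y" "sh k x \<notin> special N"
  shows "x k = y k"
proof (rule ccontr)
  assume "x k \<noteq> y k"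
  then have "sh k x 0 \<noteq> sh k y 0" by (simp add: sh_apply)
  moreover have "agree (- int N) 0 (sh k x) (sh k y)"
    by (rule agree_sh[OF assms(3)]) simp_all
  moreover have "sh k x \<in> X" "sh k y \<in> X" using assms by simp_all
  ultimately show False using assms(4) unfolding special_def by blast
qed

text \<open>Without right special words of length \<open>N\<close>, every word of that length would
  determine the whole future. Some word recurs by the pigeonhole principle, so the future from there
  on would be periodic, against \<open>no_short_repetition\<close>.\<close>

lemma special_nonempty: "special N \<noteq> {}"
proof
  assume empty: "special N = {}"
  obtain x where x: "x \<in> X" using inf by (metis finite.emptyI all_not_in_conv)
  have "finite {xs. set xs \<subseteq> A \<and> length xs = N}"
    using finite_A by (rule finite_lists_length_eq)
  moreover have "range (\<lambda>i::nat. factor x (int i) N) \<subseteq> {xs. set xs \<subseteq> A \<and> length xs = N}"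
    using x X_values by (auto simp: factor_def)
  ultimately have "\<not> inj (\<lambda>i::nat. factor x (int i) N)"
    using finite_subset range_inj_infinite by blast
  then obtain i j where ij: "i < j" "factor x (int i) N = factor x (int j) N"
    by (metis (mono_tags, lifting) injI linorder_neqE_nat)
  \<comment> \<open>The origin of \<open>y\<close> is placed just behind the first occurrence, and
    \<open>p\<close> is the distance to the second.\<close>
  define y p where "y = sh (int i + int N) x" and "p = j - i"
  have sp: "sh (int p) y = sh (int j + int N) x" using ij by (simp add: y_def p_def)
  have y: "y \<in> X" using x by (simp add: y_def)
  have start: "agree (- int N) 0 y (sh (int p) y)"
  proof -
    have "factor y (- int N) N = factor (sh (int p) y) (- int N) N"
      unfolding sp unfolding y_def factor_sh using ij by simp
    then show ?thesis by (simp add: factor_eq_iff)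
  qed
  have all: "agree (- int N) (int n) y (sh (int p) y)" for n
  proof (induction n)
    case (Suc n)
    have "y (int n) = sh (int p) y (int n)"
      using y empty by (intro nonspecial_step[where N = N] agree_mono[OF Suc]) auto
    then show ?case using Suc unfolding agree_def by (metis int_Suc le_less zless_add1_eq of_nat_Suc add.commute)
  qed (use start in simp)
  obtain L :: nat where L: "\<forall>x\<in>X. \<forall>q::nat. 1 \<le> q \<and> q \<le> p \<longrightarrow> \<not> agree (- int L) 0 x (sh (int q) x)"
    using no_short_repetition by blast
  have "agree (- int L) 0 (sh (int L) y) (sh (int L) (sh (int p) y))"
    by (rule agree_sh[OF all[of L]]) auto
  then have "agree (- int L) 0 (sh (int L) y) (sh (int p) (sh (int L) y))"
    by (simp add: algebra_simps)
  moreover have "1 \<le> p" using ij by (simp add: p_def)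
  ultimately show False using L y by (meson order_refl sh_in_iff)
qed

text \<open>The sets \<open>special N\<close> decrease in \<open>N\<close>, so compactness applies.
  Such a point will be the common point of all bases.\<close>

lemma ex_special_all: "\<exists>z. \<forall>N. z \<in> special N"
proof (rule nested_nonempty)
  show "decseq special"
    unfolding decseq_def special_def by (auto simp: agree_def)
qed (rule special_subset determined_special special_nonempty)+

definition special_words :: "nat \<Rightarrow> 'a list set" where
  "special_words N = (\<lambda>x. factor x (- int N) N) ` special N"

lemma words_eq_past: "words X n = (\<lambda>x. factor x (- int m) n) ` X"
proof
  show "words X n \<subseteq> (\<lambda>x. factor x (- int m) n) ` X"
  proof
    fix u assume "u \<in> words X n"
    then obtain x i where "x \<in> X" "u = factor x i n" by (auto simp: words_eq_factors)
    then have "u = factor (sh (i + int m) x) (- int m) n" "sh (i + int m) x \<in> X"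
      by (auto simp: factor_sh)
    then show "u \<in> (\<lambda>x. factor x (- int m) n) ` X" by blast
  qed
qed (auto simp: words_eq_factors)

lemma finite_words: "finite (words X n)"
proof (rule finite_subset)
  show "words X n \<subseteq> {xs. set xs \<subseteq> A \<and> length xs = n}"
    using X_values by (auto simp: words_eq_factors factor_def)
  show "finite {xs. set xs \<subseteq> A \<and> length xs = n}"
    using finite_A by (rule finite_lists_length_eq)
qed

lemma special_words_subset: "special_words N \<subseteq> words X N"
  unfolding special_words_def words_eq_past[of N N] using special_subset by auto

text \<open>Every word of length \<open>N\<close> extends to the right, and a right special one in
  at least two ways.\<close>

lemma complexity_step: "complexity X N + card (special_words N) \<le> complexity X (N + 1)"
proof -
  let ?f = "\<lambda>x. factor x (- int N) N" and ?g = "\<lambda>x. factor x (- int N) (N + 1)"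
  have g_eq: "?g x = ?g y \<longleftrightarrow> agree (- int N) 1 x y" for x y :: "int \<Rightarrow> 'a"
    by (simp add: factor_eq_iff del: add_Suc_right add_Suc)
  have f_eq: "?f x = ?f y \<longleftrightarrow> agree (- int N) 0 x y" for x y :: "int \<Rightarrow> 'a"
    by (simp add: factor_eq_iff)
  have "\<forall>u\<in>words X N. \<exists>x. x \<in> X \<and> ?f x = u"
    unfolding words_eq_past[of N N] by blast
  \<comment> \<open>\<open>c\<close> realises one extension of each word; \<open>d\<close> below
    realises a second one for each right special word.\<close>
  then obtain c where c: "\<forall>u\<in>words X N. c u \<in> X \<and> ?f (c u) = u"
    by (rule bchoice[THEN exE])
  have "\<exists>y\<in>X. agree (- int N) 0 (c u) y \<and> c u 0 \<noteq> y 0" if u: "u \<in> special_words N" for u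
  proof -
    obtain x where x: "x \<in> special N" "u = ?f x" using u by (auto simp: special_words_def)
    have "c u \<in> X" "?f (c u) = ?f x" using c u x special_words_subset by blast+
    then have "c u \<in> special N" using special_past[OF x(1)] by (metis f_eq)
    then show ?thesis by (simp add: special_def)
  qed
  then obtain d where d: "\<forall>u\<in>special_words N. d u \<in> X \<and> agree (- int N) 0 (c u) (d u) \<and> c u 0 \<noteq> d u 0"
    by metis
  have fd: "?f (d u) = u" if "u \<in> special_words N" for u
    using d c that special_words_subset f_eq by (metis subsetD)
  have inj_c: "inj_on (\<lambda>u. ?g (c u)) (words X N)"
  proof (rule inj_onI)
    fix u v assume "u \<in> words X N" "v \<in> words X N" "?g (c u) = ?g (c v)"
    then show "u = v" using c f_eq g_eq agree_mono[of "- int N" 1 "c u" "c v" "- int N" 0]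
      by (metis order_refl zero_le_one)
  qed
  have inj_d: "inj_on (\<lambda>u. ?g (d u)) (special_words N)"
  proof (rule inj_onI)
    fix u v assume "u \<in> special_words N" "v \<in> special_words N" "?g (d u) = ?g (d v)"
    then show "u = v" using fd f_eq g_eq agree_mono[of "- int N" 1 "d u" "d v" "- int N" 0]
      by (metis order_refl zero_le_one)
  qed
  have disj: "(\<lambda>u. ?g (c u)) ` words X N \<inter> (\<lambda>u. ?g (d u)) ` special_words N = {}"
  proof -
    have False if "u \<in> words X N" "v \<in> special_words N" "?g (c u) = ?g (d v)" for u v
    proof -
      have ag: "agree (- int N) 1 (c u) (d v)" using that g_eq by blast
      then have "?f (c u) = ?f (d v)" using f_eq agree_mono by (metis order_refl zero_le_one)
      then have "u = v" using c fd that by metis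
      moreover have "c u 0 = d v 0" using agreeD[OF ag, of 0] by simp
      ultimately show False using d that by blast
    qed
    then show ?thesis by blast
  qed
  have fin: "finite (special_words N)" using finite_words special_words_subset finite_subset by blast
  have "complexity X N + card (special_words N)
      = card ((\<lambda>u. ?g (c u)) ` words X N \<union> (\<lambda>u. ?g (d u)) ` special_words N)"
    using finite_words fin disj inj_c inj_d
    by (subst card_Un_disjoint) (auto simp: card_image complexity_def)
  also have "\<dots> \<le> complexity X (N + 1)"
    unfolding complexity_def
  proof (rule card_mono[OF finite_words])
    show "(\<lambda>u. ?g (c u)) ` words X N \<union> (\<lambda>u. ?g (d u)) ` special_words N \<subseteq> words X (N + 1)"
      unfolding words_eq_past[of "N + 1" N] using c d by blast
  qed
  finally show ?thesis .
qed

end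

subsection \<open>Counting return words\<close>

text \<open>The value of \<open>r\<close> depends only on the code \<open>c\<close>, so choosing one
  preimage of each value embeds the image of \<open>r\<close> into the set of codes.\<close>

lemma card_image_le_via:
  assumes "finite T" "\<And>v. v \<in> D \<Longrightarrow> c v \<in> T"
    and "\<And>u v. u \<in> D \<Longrightarrow> v \<in> D \<Longrightarrow> c u = c v \<Longrightarrow> r u = r v"
  shows "finite (r ` D) \<and> card (r ` D) \<le> card T"
proof -
  let ?g = "\<lambda>b. c (inv_into D r b)"
  have g: "inv_into D r b \<in> D" "r (inv_into D r b) = b" if "b \<in> r ` D" for b
    using that by (auto intro: inv_into_into f_inv_into_f)
  have inj: "inj_on ?g (r ` D)"
  proof (rule inj_onI)
    fix a b assume ab: "a \<in> r ` D" "b \<in> r ` D" "?g a = ?g b"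
    have "r (inv_into D r a) = r (inv_into D r b)"
      using assms(3)[OF g(1)[OF ab(1)] g(1)[OF ab(2)] ab(3)] .
    then show "a = b" using ab by (simp add: g(2))
  qed
  have sub: "?g ` (r ` D) \<subseteq> T" using g assms(2) by auto
  show ?thesis
    by (intro conjI inj_on_finite[OF inj sub assms(1)] card_inj_on_le[OF inj sub assms(1)])
qed

text \<open>Returns are taken backwards because the base is the last level of a tower that a moving
  point visits.\<close>

definition backtime :: "(int \<Rightarrow> 'a) set \<Rightarrow> (int \<Rightarrow> 'a) \<Rightarrow> nat" where
  "backtime D x = (LEAST h. 1 \<le> h \<and> sh (- int h) x \<in> D)"

text \<open>The margins of \<open>n\<close> letters on both sides will make all points of one tower
  level share the central window of radius \<open>n\<close>.\<close>

definition return_word :: "nat \<Rightarrow> (int \<Rightarrow> 'a) set \<Rightarrow> (int \<Rightarrow> 'a) \<Rightarrow> 'a list" where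
  "return_word n D x = factor x (- int (backtime D x) - int n) (backtime D x + 2 * n)"

lemma backtime_eqI:
  assumes "1 \<le> h" "sh (- int h) x \<in> D" "\<And>i. 1 \<le> i \<Longrightarrow> i < h \<Longrightarrow> sh (- int i) x \<notin> D"
  shows "backtime D x = h"
  unfolding backtime_def
  by (rule Least_equality) (use assms in \<open>auto simp: not_less[symmetric]\<close>)

lemma backtime_minimal: "1 \<le> i \<Longrightarrow> i < backtime D x \<Longrightarrow> sh (- int i) x \<notin> D"
  unfolding backtime_def using not_less_Least by blast

text \<open>A time is marked if \<open>F\<close> is visited for the first time since the last visit to \<open>E\<close>, where a
  simultaneous visit to \<open>E\<close> counts as earlier.\<close>

definition firsts :: "(int \<Rightarrow> 'a) set \<Rightarrow> (int \<Rightarrow> 'a) set \<Rightarrow> (int \<Rightarrow> 'a) set" where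
  "firsts F E = {x \<in> F. \<forall>p\<ge>1. sh (- p) x \<in> F \<longrightarrow> (\<exists>q. 0 \<le> q \<and> q < p \<and> sh (- q) x \<in> E)}"

text \<open>Here \<open>f < m\<close> are the first two marked times of \<open>x\<close>.\<close>

definition block ::
    "(int \<Rightarrow> 'a) set \<Rightarrow> (int \<Rightarrow> 'a) set \<Rightarrow> (int \<Rightarrow> 'a) \<Rightarrow> int \<Rightarrow> int \<Rightarrow> bool" where
  "block F E x f m \<longleftrightarrow>
     x \<in> E \<and> 0 \<le> f \<and> f < m \<and> sh f x \<in> firsts F E \<and> sh m x \<in> firsts F E \<and>
     (\<forall>s. 0 \<le> s \<and> s < m \<and> s \<noteq> f \<longrightarrow> sh s x \<notin> firsts F E) \<and>
     (\<forall>s. 0 < s \<and> s \<le> f \<longrightarrow> sh s x \<notin> E)"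

section \<open>Codes for the blocks between consecutive marked times\<close>

context infinite_minimal_subshift
begin

lemma backtime_exists:
  assumes "D \<subseteq> X" "determined w D" "D \<noteq> {}" "x \<in> X"
  shows "1 \<le> backtime D x \<and> sh (- int (backtime D x)) x \<in> D"
proof -
  obtain R :: nat where "\<forall>x\<in>X. \<exists>i\<le>R. sh (int i) x \<in> D"
    using syndetic[OF assms(1-3)] by blast
  \<comment> \<open>Starting \<open>R + 1\<close> steps back makes the return time
    \<open>R + 1 - i\<close> at least \<open>1\<close>.\<close>
  then obtain i where i: "i \<le> R" "sh (int i) (sh (- int (R + 1)) x) \<in> D"
    using assms(4) sh_in_iff by blast
  then have "1 \<le> R + 1 - i \<and> sh (- int (R + 1 - i)) x \<in> D"
    by (simp add: of_nat_diff algebra_simps)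
  then show ?thesis unfolding backtime_def by (rule LeastI)
qed

text \<open>These are the letters that the past does not force; together with the last
  \<open>N\<close> letters before the origin they encode a block.\<close>

definition letters :: "nat \<Rightarrow> (int \<Rightarrow> 'a) \<Rightarrow> int \<Rightarrow> 'a list" where
  "letters N x m = map x (filter (\<lambda>s. sh s x \<in> special N) [0..m - 1])"

lemma special_cong:
  assumes "x \<in> X" "y \<in> X" "agree (- int N) m x y" "0 \<le> s" "s \<le> m"
  shows "sh s x \<in> special N \<longleftrightarrow> sh s y \<in> special N"
proof -
  have "agree (- int N) 0 (sh s x) (sh s y)"
    by (rule agree_sh[OF assms(3)]) (use assms in simp_all)
  then show ?thesis
    using assms(1,2) agree_sym special_past by (metis sh_in_iff)
qed

lemma letters_cong:
  assumes "x \<in> X" "y \<in> X" "agree (- int N) m x y"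
  shows "letters N x m = letters N y m"
proof -
  have "filter (\<lambda>s. sh s x \<in> special N) [0..m - 1] = filter (\<lambda>s. sh s y \<in> special N) [0..m - 1]"
    using special_cong[OF assms] by (intro filter_cong) auto
  then show ?thesis
    using assms(3) unfolding letters_def by (auto simp: agree_def)
qed

lemma letters_split:
  assumes "0 \<le> k" "k < m" "sh k x \<in> special N"
  shows "\<exists>t. letters N x m = letters N x k @ x k # t"
proof -
  have "[0..m - 1] = [0..k - 1] @ k # [k + 1..m - 1]"
    using assms by (simp add: upto_split3)
  then show ?thesis using assms(3) by (simp add: letters_def)
qed

text \<open>Outside right special words the past determines the next letter.\<close>

lemma agree_of_letters:
  assumes xy: "x \<in> X" "y \<in> X" "agree (- int N) 0 x y"
    and l: "letters N x m = letters N y m'"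
  shows "int k \<le> m \<Longrightarrow> int k \<le> m' \<Longrightarrow> agree (- int N) (int k) x y"
proof (induction k)
  case (Suc k)
  then have IH: "agree (- int N) (int k) x y" by simp
  have sp: "sh (int k) x \<in> special N \<longleftrightarrow> sh (int k) y \<in> special N"
    by (rule special_cong[OF xy(1,2) IH]) simp_all
  have "x (int k) = y (int k)"
  proof (cases "sh (int k) x \<in> special N")
    case True
    obtain t where t: "letters N x m = letters N x (int k) @ x (int k) # t"
      using letters_split[of "int k" m x N] True Suc by auto
    obtain t' where t': "letters N y m' = letters N y (int k) @ y (int k) # t'"
      using letters_split[of "int k" m' y N] True sp Suc by auto
    \<comment> \<open>By \<open>letters_cong\<close> the two prefixes coincide, so both
      decompositions show the letter at time \<open>k\<close> in the same place.\<close>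
    show ?thesis using t t' l letters_cong[OF xy(1,2) IH] by simp
  next
    case False
    show ?thesis
      by (rule nonspecial_step[OF xy(1,2) _ False]) (rule agree_mono[OF IH], simp_all)
  qed
  then show ?case
    using IH unfolding agree_def by (metis int_ops(4) less_add_one linorder_less_linear order_le_less zle_add1_eq_le)
qed (use xy in simp)

text \<open>The visit of \<open>y\<close> to \<open>special N\<close> at time \<open>0\<close>
  screens off its earlier visits to \<open>F\<close>, and from time \<open>0\<close> to
  \<open>m\<close> both points make the same visits.\<close>

lemma firsts_agree:
  assumes past: "\<And>x y. x \<in> X \<Longrightarrow> y \<in> X \<Longrightarrow> agree (- int N) 0 x y \<Longrightarrow> x \<in> F \<Longrightarrow> y \<in> F"
    and xy: "y \<in> special N" "x \<in> X" "agree (- int N) m x y"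
    and s: "0 \<le> s" "s \<le> m" "sh s x \<in> firsts F (special N)"
  shows "sh s y \<in> firsts F (special N)"
proof -
  have yX: "y \<in> X" using xy special_subset by blast
  have ag: "agree (- int N) 0 (sh t x) (sh t y)" if "0 \<le> t" "t \<le> m" for t
    by (rule agree_sh[OF xy(3)]) (use that in simp_all)
  have F: "sh t x \<in> F \<longleftrightarrow> sh t y \<in> F" if "0 \<le> t" "t \<le> m" for t
    using ag[OF that] past[of "sh t x" "sh t y"] past[of "sh t y" "sh t x"] xy yX
    by (auto dest: agree_sym)
  have "\<exists>q. 0 \<le> q \<and> q < p \<and> sh (- q) (sh s y) \<in> special N"
    if p: "1 \<le> p" "sh (- p) (sh s y) \<in> F" for p
  proof (cases "p \<le> s")
    case False
    \<comment> \<open>The earlier visit to \<open>F\<close> lies before time \<open>0\<close>, and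
      the visit of \<open>y\<close> to \<open>special N\<close> at \<open>0\<close> comes in
      between.\<close>
    then show ?thesis using s xy(1) by (intro exI[of _ s]) auto
  next
    case True
    have "sh (s - p) y \<in> F" using p(2) by (simp add: algebra_simps)
    then have "sh (- p) (sh s x) \<in> F" using F[of "s - p"] True s p by simp
    then obtain q where q: "0 \<le> q" "q < p" "sh (- q) (sh s x) \<in> special N"
      using s(3) p(1) unfolding firsts_def by blast
    then have "sh (s - q) x \<in> special N" by (simp add: algebra_simps)
    then have "sh (s - q) y \<in> special N"
      using special_cong[OF xy(2) yX xy(3), of "s - q"] q True s by simp
    then show ?thesis using q by (intro exI[of _ q]) (simp add: algebra_simps)
  qed
  then show ?thesis using s F[of s] unfolding firsts_def by simp
qed

text \<open>The code gives agreement up to the shorter end \<open>m\<close>, which carries both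
  marks of \<open>x\<close> over to \<open>y\<close>. From time \<open>0\<close> on,
  \<open>y\<close> has only the mark \<open>f'\<close> before \<open>m'\<close>, so
  \<open>f = f'\<close>, and then \<open>m\<close> can only be \<open>m'\<close>.\<close>

lemma block_determined_le:
  assumes past: "\<And>x y. x \<in> X \<Longrightarrow> y \<in> X \<Longrightarrow> agree (- int N) 0 x y \<Longrightarrow> x \<in> F \<Longrightarrow> y \<in> F"
    and b: "block F (special N) x f m" "block F (special N) y f' m'"
    and ag: "agree (- int N) 0 x y" and l: "letters N x m = letters N y m'" and le: "m \<le> m'"
  shows "f = f' \<and> m = m' \<and> agree (- int N) m x y"
proof -
  let ?G = "firsts F (special N)"
  have xy: "x \<in> X" "y \<in> X" "y \<in> special N"
    using b special_subset unfolding block_def by blast+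
  have m: "0 \<le> f" "f < m" using b(1) unfolding block_def by blast+
  have A: "agree (- int N) m x y"
    using agree_of_letters[OF xy(1,2) ag l, of "nat m"] m le by simp
  have "sh f x \<in> ?G" "sh m x \<in> ?G" using b(1) unfolding block_def by blast+
  then have G: "sh f y \<in> ?G" "sh m y \<in> ?G"
    using firsts_agree[OF past xy(3,1) A] m by auto
  have f: "f = f'" using G(1) b(2) m le unfolding block_def by (metis order_less_le_trans)
  moreover have "m = m'"
  proof (rule ccontr)
    assume "m \<noteq> m'"
    then have "m = f'" using G(2) b(2) m le unfolding block_def by (metis less_le order_trans less_imp_le)
    then show False using f m by simp
  qed
  ultimately show ?thesis using A by blast
qed

lemma block_determined:
  assumes past: "\<And>x y. x \<in> X \<Longrightarrow> y \<in> X \<Longrightarrow> agree (- int N) 0 x y \<Longrightarrow> x \<in> F \<Longrightarrow> y \<in> F"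
    and b: "block F (special N) x f m" "block F (special N) y f' m'"
    and ag: "agree (- int N) 0 x y" and l: "letters N x m = letters N y m'"
  shows "f = f' \<and> m = m' \<and> agree (- int N) m x y"
proof (cases "m \<le> m'")
  case True
  show ?thesis by (rule block_determined_le[OF past b ag l True])
next
  case False
  then have "f' = f \<and> m' = m \<and> agree (- int N) m' y x"
    by (intro block_determined_le[OF past b(2,1) agree_sym[OF ag] l[symmetric]]) auto
  then show ?thesis using agree_sym by blast
qed

text \<open>Between two consecutive marked times the right special words visited are pairwise different,
  since a repetition would have a period of at most \<open>R\<close>.\<close>

lemma length_letters_block:
  assumes b: "block F (special N) x f m"
    and R: "\<And>x. x \<in> X \<Longrightarrow> \<exists>i\<le>R. sh (int i) x \<in> F"
    and rep: "\<And>x p. x \<in> X \<Longrightarrow> 1 \<le> p \<Longrightarrow> p \<le> R \<Longrightarrow> \<not> agree (- int N) 0 x (sh (int p) x)"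
  shows "length (letters N x m) \<le> card (special_words N) + 1"
proof -
  let ?E = "special N" and ?G = "firsts F (special N)"
  define S where "S = {s. f < s \<and> s < m \<and> sh s x \<in> ?E}"
  have x: "x \<in> X" "x \<in> ?E" and fm: "0 \<le> f" "f < m"
    using b special_subset unfolding block_def by blast+
  have noG: "sh s x \<notin> ?G" if "f < s" "s < m" for s
    using b that fm unfolding block_def by auto
  \<comment> \<open>The first visit to \<open>F\<close> from \<open>s\<close> on would be marked,
    since \<open>s\<close> is a visit to \<open>special N\<close>; but no mark lies strictly between
    \<open>f\<close> and \<open>m\<close>.\<close>
  have noF: "sh e x \<notin> F" if s: "s \<in> S" and e: "s \<le> e" "e < m" for s e
  proof
    assume "sh e x \<in> F"
    define j where "j = (LEAST j. sh (s + int j) x \<in> F)"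
    have "sh (s + int (nat (e - s))) x \<in> F" using \<open>sh e x \<in> F\<close> e by simp
    then have j: "sh (s + int j) x \<in> F" and jle: "j \<le> nat (e - s)"
      unfolding j_def by (rule LeastI, rule Least_le)
    have jmin: "sh (s + int i) x \<notin> F" if "i < j" for i
      using that not_less_Least unfolding j_def by blast
    have "sh (s + int j) x \<in> ?G"
      unfolding firsts_def
    proof (safe intro!: j)
      fix p assume p: "1 \<le> p" "sh (- p) (sh (s + int j) x) \<in> F"
      have "p > int j"
      proof (rule ccontr)
        assume "\<not> p > int j"
        then obtain i where i: "int i = int j - p" by (metis diff_ge_0_iff_ge not_less zero_le_imp_eq_int)
        then have "s + int i = - p + (s + int j)" by simp
        then have "sh (s + int i) x \<in> F" using p(2) by (metis sh_sh)
        moreover have "i < j" using i p(1) by simp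
        ultimately show False using jmin by blast
      qed
      moreover have "sh (- int j) (sh (s + int j) x) \<in> ?E" using s by (simp add: S_def)
      ultimately show "\<exists>q\<ge>0. q < p \<and> sh (- q) (sh (s + int j) x) \<in> ?E"
        by (intro exI[of _ "int j"]) simp
    qed
    moreover have "f < s + int j" "s + int j < m" using s jle e by (auto simp: S_def)
    ultimately show False using noG by blast
  qed
  have no_rep: False
    if st: "s \<in> S" "t \<in> S" "s < t" and eq: "factor (sh s x) (- int N) N = factor (sh t x) (- int N) N"
    for s t
  proof -
    obtain i where i: "i \<le> R" "sh (int i) (sh s x) \<in> F" using R[of "sh s x"] x by auto
    \<comment> \<open>\<open>F\<close> is met within \<open>R\<close> steps of \<open>s\<close> but
      not before \<open>m\<close>, so \<open>s\<close> and \<open>t\<close> are at most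
      \<open>R\<close> apart.\<close>
    have "\<not> s + int i < m" using noF[OF st(1), of "s + int i"] i(2) by (auto simp: add.commute)
    then have "t - s \<le> int R" using st i by (auto simp: S_def)
    moreover have "agree (- int N) 0 (sh s x) (sh t x)" using eq by (simp add: factor_eq_iff)
    moreover have "sh t x = sh (int (nat (t - s))) (sh s x)" using st by simp
    moreover have "1 \<le> nat (t - s)" "nat (t - s) \<le> R" "sh s x \<in> X"
      using \<open>t - s \<le> int R\<close> st x by auto
    ultimately show False using rep by metis
  qed
  have "inj_on (\<lambda>s. factor (sh s x) (- int N) N) S"
    using no_rep by (intro inj_onI) (metis linorder_neqE)
  moreover have "(\<lambda>s. factor (sh s x) (- int N) N) ` S \<subseteq> special_words N"
    by (auto simp: S_def special_words_def)
  moreover have "finite (special_words N)"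
    using finite_words special_words_subset finite_subset by blast
  ultimately have "card S \<le> card (special_words N)" by (rule card_inj_on_le)
  \<comment> \<open>Time \<open>0\<close> is the only visit to \<open>special N\<close> up to
    \<open>f\<close>; it accounts for the extra \<open>1\<close> in the bound.\<close>
  moreover have "length (letters N x m) \<le> card (insert 0 S)"
  proof -
    have "length (letters N x m) = card (set (filter (\<lambda>s. sh s x \<in> ?E) [0..m - 1]))"
      unfolding letters_def by (simp only: length_map) (metis distinct_card distinct_filter distinct_upto)
    also have "\<dots> \<le> card (insert 0 S)"
    proof (rule card_mono)
      have "finite {f<..<m}" by simp
      then show "finite (insert 0 S)" by (rule finite_subset[rotated, THEN finite.insertI]) (auto simp: S_def)
      show "set (filter (\<lambda>s. sh s x \<in> ?E) [0..m - 1]) \<subseteq> insert 0 S"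
      proof
        fix s assume "s \<in> set (filter (\<lambda>s. sh s x \<in> ?E) [0..m - 1])"
        then have s: "0 \<le> s" "s < m" "sh s x \<in> ?E" by auto
        show "s \<in> insert 0 S"
        proof (cases "s \<le> f")
          case True
          then show ?thesis using b s unfolding block_def by fastforce
        qed (use s in \<open>auto simp: S_def\<close>)
      qed
    qed
    finally show ?thesis .
  qed
  moreover have "card (insert 0 S) \<le> Suc (card S)" by (rule card_insert_le_m1) auto
  ultimately show ?thesis by simp
qed

text \<open>The block ends at the mark belonging to \<open>v\<close>; \<open>f\<close> is the mark
  before it, reached by the backward return, and the origin of \<open>x\<close> is the last visit to
  \<open>special N\<close> up to \<open>f\<close>. No mark lies between that visit and
  \<open>f\<close>, since \<open>f\<close> is the first visit to \<open>F\<close> after it.\<close>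

lemma block_exists:
  assumes D: "D = {x \<in> X. sh (int n) x \<in> firsts F (special N)}" "determined w D" and v: "v \<in> D"
  shows "\<exists>x f m. block F (special N) x f m \<and> v = sh (m - int n) x \<and> int (backtime D v) = m - f"
proof -
  let ?E = "special N" and ?G = "firsts F (special N)"
  define h where "h = backtime D v"
  have vX: "v \<in> X" and DX: "D \<subseteq> X" using D v by auto
  have h: "1 \<le> h" "sh (- int h) v \<in> D"
    using backtime_exists[OF DX D(2) _ vX] v unfolding h_def by blast+
  have hmin: "sh (- int i) v \<notin> D" if "1 \<le> i" "i < h" for i
    using that backtime_minimal unfolding h_def by blast
  have inD: "sh i v \<in> D \<longleftrightarrow> sh (int n + i) v \<in> ?G" for i using D(1) vX by simp
  define u where "u = sh (int n - int h) v"
  have uX: "u \<in> X" using vX by (simp add: u_def)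
  define t where "t = (LEAST t. sh (- int t) u \<in> ?E)"
  have "\<exists>t. sh (- int t) u \<in> ?E"
    using backtime_exists[OF special_subset determined_special special_nonempty uX] by blast
  then have t: "sh (- int t) u \<in> ?E" unfolding t_def by (rule LeastI_ex)
  have tmin: "sh (- int i) u \<notin> ?E" if "i < t" for i
    using that not_less_Least unfolding t_def by blast
  define x where "x = sh (- int t) u"
  define m where "m = int t + int h"
  have sx: "sh s x = sh (s - int t) u" for s by (simp add: x_def)
  have sv: "sh s x = sh (int n + (s - m)) v" for s by (simp add: x_def u_def m_def algebra_simps)
  have G0: "u \<in> ?G" using h(2) inD[of "- int h"] by (simp add: u_def)
  have noE: "sh s x \<notin> ?E" if "0 < s" "s \<le> int t" for s
    using tmin[of "nat (int t - s)"] that by (simp add: sx)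
  have "sh s x \<notin> ?G" if s: "0 \<le> s" "s < m" "s \<noteq> int t" for s
  proof (cases "s < int t")
    case True
    show ?thesis
    proof
      assume "sh s x \<in> ?G"
      then have "sh (- (int t - s)) u \<in> F" by (simp add: sx firsts_def)
      moreover have "1 \<le> int t - s" using True by simp
      ultimately obtain q where q: "0 \<le> q" "q < int t - s" "sh (- q) u \<in> ?E"
        using G0 unfolding firsts_def by blast
      then have "nat q < t" using s by linarith
      then show False using tmin[of "nat q"] q by simp
    qed
  next
    case False
    then have "nat (m - s) \<ge> 1" "nat (m - s) < h" using s by (auto simp: m_def)
    then have "sh (- int (nat (m - s))) v \<notin> D" by (rule hmin)
    then show ?thesis using inD[of "s - m"] s by (simp add: sv)
  qed
  moreover have "sh m x \<in> ?G" using v inD[of 0] by (simp add: sv)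
  moreover have "sh (int t) x \<in> ?G" using G0 by (simp add: sx)
  ultimately have "block F ?E x (int t) m"
    using t noE h unfolding block_def by (auto simp: x_def m_def)
  moreover have "v = sh (m - int n) x" by (simp add: sv)
  moreover have "int (backtime D v) = m - int t" by (simp add: m_def h_def)
  ultimately show ?thesis by blast
qed

text \<open>The right special word at the start of a block and the letters along the block determine
  the return word. There are at most \<open>K\<close> such words, and
  \<open>length_letters_block\<close> limits the letters to words of length at most
  \<open>K + 1\<close> over \<open>A\<close>.\<close>

lemma card_return_words:
  assumes D: "D = {x \<in> X. sh (int n) x \<in> firsts F (special N)}" "determined w D"
    and past: "\<And>x y. x \<in> X \<Longrightarrow> y \<in> X \<Longrightarrow> agree (- int N) 0 x y \<Longrightarrow> x \<in> F \<Longrightarrow> y \<in> F"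
    and R: "\<And>x. x \<in> X \<Longrightarrow> \<exists>i\<le>R. sh (int i) x \<in> F"
    and rep: "\<And>x p. x \<in> X \<Longrightarrow> 1 \<le> p \<Longrightarrow> p \<le> R \<Longrightarrow> \<not> agree (- int N) 0 x (sh (int p) x)"
    and N: "2 * n \<le> N" and K: "card (special_words N) \<le> K"
  shows "finite (return_word n D ` D) \<and>
    card (return_word n D ` D) \<le> K * (\<Sum>i\<le>K + 1. card A ^ i)"
proof -
  let ?T = "special_words N \<times> {xs. set xs \<subseteq> A \<and> length xs \<le> K + 1}"
  have "\<forall>v\<in>D. \<exists>q. block F (special N) (fst q) (fst (snd q)) (snd (snd q)) \<and>
      v = sh (snd (snd q) - int n) (fst q) \<and> int (backtime D v) = snd (snd q) - fst (snd q)"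
    using block_exists[OF D] by (metis fst_conv snd_conv)
  then obtain q where q: "\<And>v. v \<in> D \<Longrightarrow> block F (special N) (fst (q v)) (fst (snd (q v))) (snd (snd (q v))) \<and>
      v = sh (snd (snd (q v)) - int n) (fst (q v)) \<and> int (backtime D v) = snd (snd (q v)) - fst (snd (q v))"
    by metis
  define x f m where "x = (\<lambda>v. fst (q v))" and "f = (\<lambda>v. fst (snd (q v)))" and "m = (\<lambda>v. snd (snd (q v)))"
  have b: "block F (special N) (x v) (f v) (m v)" and v_eq: "v = sh (m v - int n) (x v)"
    and h: "int (backtime D v) = m v - f v" if "v \<in> D" for v
    using q[OF that] unfolding x_def f_def m_def by blast+
  have xX: "x v \<in> special N" "x v \<in> X" if "v \<in> D" for v
    using b[OF that] special_subset unfolding block_def by blast+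
  have rw: "return_word n D v = factor (x v) (f v - 2 * int n) (backtime D v + 2 * n)" if "v \<in> D" for v
  proof -
    have "return_word n D v = factor (sh (m v - int n) (x v)) (- int (backtime D v) - int n) (backtime D v + 2 * n)"
      unfolding return_word_def using v_eq[OF that] by simp
    moreover have "- int (backtime D v) - int n + (m v - int n) = f v - 2 * int n" using h[OF that] by simp
    ultimately show ?thesis unfolding factor_sh by simp
  qed
  let ?c = "\<lambda>v. (factor (x v) (- int N) N, letters N (x v) (m v))"
  have "finite (special_words N)"
    by (rule finite_subset[OF special_words_subset finite_words])
  moreover have "finite {xs. set xs \<subseteq> A \<and> length xs \<le> K + 1}"
    using finite_A by (rule finite_lists_length_le)
  ultimately have fin: "finite ?T" by blast
  have "finite (return_word n D ` D) \<and> card (return_word n D ` D) \<le> card ?T"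
  proof (rule card_image_le_via[where c = ?c])
    show "finite ?T" by (rule fin)
  next
    fix v assume v: "v \<in> D"
    have "length (letters N (x v) (m v)) \<le> K + 1"
      using length_letters_block[OF b[OF v] R rep] K by simp
    moreover have "set (letters N (x v) (m v)) \<subseteq> A"
      using X_values xX[OF v] by (auto simp: letters_def)
    moreover have "factor (x v) (- int N) N \<in> special_words N"
      using xX[OF v] by (auto simp: special_words_def)
    ultimately show "?c v \<in> ?T" by blast
  next
    fix u v assume uv: "u \<in> D" "v \<in> D" "?c u = ?c v"
    have "agree (- int N) 0 (x u) (x v)" using uv(3) by (simp add: factor_eq_iff)
    then have *: "f u = f v \<and> m u = m v \<and> agree (- int N) (m u) (x u) (x v)"
      using uv by (intro block_determined[OF past b b]) auto
    then have hh: "backtime D u = backtime D v" using h[OF uv(1)] h[OF uv(2)] by simp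
    \<comment> \<open>The return word occupies the window from \<open>f u - 2 * int n\<close> to
      \<open>m u\<close>, which \<open>2 * n \<le> N\<close> keeps inside the window of
      agreement.\<close>
    have "0 \<le> f u" using b[OF uv(1)] unfolding block_def by blast
    then have "agree (f u - 2 * int n) (f u - 2 * int n + int (backtime D u + 2 * n)) (x u) (x v)"
      using * N h[OF uv(1)] by (auto intro: agree_mono[where a = "- int N" and b = "m u"])
    then show "return_word n D u = return_word n D v"
      using * hh unfolding rw[OF uv(1)] rw[OF uv(2)] by (metis factor_eq_iff)
  qed
  moreover have "card ?T \<le> K * (\<Sum>i\<le>K + 1. card A ^ i)"
    using K by (simp only: card_cartesian_product card_lists_length_le[OF finite_A] mult_le_mono1)
  ultimately show ?thesis by linarith
qed

end

subsection \<open>Kakutani-Rohlin partitions from return words\<close>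

definition first_hit :: "(int \<Rightarrow> 'a) set \<Rightarrow> (int \<Rightarrow> 'a) \<Rightarrow> nat" where
  "first_hit D x = (LEAST j. sh (int j) x \<in> D)"

definition enum :: "'b set \<Rightarrow> nat \<Rightarrow> 'b" where
  "enum W = (SOME f. bij_betw f {1..card W} W)"

lemma bij_enum: "finite W \<Longrightarrow> bij_betw (enum W) {1..card W} W"
  unfolding enum_def by (rule someI_ex[OF ex_bij_betw_nat_finite_1])

definition return_towers :: "nat \<Rightarrow> (int \<Rightarrow> 'a) set \<Rightarrow> (int \<Rightarrow> 'a) towers" where
  "return_towers n D =
     \<lparr> num_towers = card (return_word n D ` D),
       base = (\<lambda>k. {x \<in> D. return_word n D x = enum (return_word n D ` D) k}),
       height = (\<lambda>k. length (enum (return_word n D ` D) k) - 2 * n) \<rparr>"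

lemma return_word_eq_imp_agree:
  assumes "return_word n D x = return_word n D y"
  shows "agree (- int (backtime D x) - int n) (int n) x y"
proof -
  have "length (return_word n D x) = length (return_word n D y)" using assms by simp
  then have h: "backtime D y = backtime D x" by (simp add: return_word_def)
  show "agree (- int (backtime D x) - int n) (int n) x y"
    using assms unfolding return_word_def h factor_eq_iff by (simp add: agree_def)
qed

section \<open>A clopen base around the point with right special pasts\<close>

context infinite_minimal_subshift
begin

text \<open>The choices come in the order \<open>L\<close>, \<open>R\<close>, \<open>L'\<close>,
  \<open>N\<close>: \<open>L\<close> excludes periods up to \<open>n\<close>, \<open>R\<close>
  bounds the gaps between visits to \<open>F\<close>, \<open>L'\<close> excludes periods up to
  \<open>R\<close>, and only then is \<open>N\<close> taken large with few right special
  words.\<close>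

lemma ex_good_base:
  assumes z: "\<And>N. z \<in> special N"
    and K: "\<And>N0. \<exists>N\<ge>N0. complexity X (N + 1) \<le> complexity X N + K"
  shows "\<exists>D w. D \<subseteq> X \<and> determined w D \<and> z \<in> D \<and> (\<forall>x\<in>D. agree (- int n) (int n) x z) \<and>
    (\<forall>x\<in>D. \<forall>p::nat. 1 \<le> p \<and> p \<le> n \<longrightarrow> sh (int p) x \<notin> D) \<and>
    finite (return_word n D ` D) \<and> card (return_word n D ` D) \<le> K * (\<Sum>i\<le>K + 1. card A ^ i)"
proof -
  have zX: "z \<in> X" using z special_subset by blast
  obtain L :: nat where L: "\<And>x p. x \<in> X \<Longrightarrow> 1 \<le> p \<Longrightarrow> p \<le> n \<Longrightarrow> \<not> agree (- int L) 0 x (sh (int p) x)"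
    using no_short_repetition[of n] by blast
  define l where "l = max L n"
  have l: "L \<le> l" "n \<le> l" by (auto simp: l_def)
  \<comment> \<open>\<open>F\<close> consists of the points at which the word read by
    \<open>z\<close> from \<open>- l\<close> to \<open>n\<close> has just been completed, so
    membership depends on the past alone. Its origin is \<open>n\<close> later than that of
    \<open>D\<close> below.\<close>
  define F where "F = {x \<in> X. agree (- int (l + n)) 0 x (sh (int n) z)}"
  have Fpast: "y \<in> F" if "y \<in> X" "agree (- int m) 0 x y" "x \<in> F" "l + n \<le> m" for x y m
  proof -
    have "agree (- int (l + n)) 0 x y" by (rule agree_mono[OF that(2)]) (use that(4) in simp_all)
    then have "agree (- int (l + n)) 0 y x" by (rule agree_sym)
    then show ?thesis using that(1,3) agree_trans unfolding F_def by blast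
  qed
  have "determined (int (l + n)) F"
  proof (rule determinedI)
    fix x y assume *: "x \<in> X" "y \<in> X" "agree (- int (l + n)) (int (l + n)) x y" "x \<in> F"
    show "y \<in> F" by (rule Fpast[OF *(2) agree_mono[OF *(3)] *(4), of "l + n"]) simp_all
  qed
  note detF = this
  have nzF: "sh (int n) z \<in> F" using zX by (simp add: F_def agree_def)
  have "F \<subseteq> X" by (auto simp: F_def)
  then obtain R :: nat where R: "\<And>x. x \<in> X \<Longrightarrow> \<exists>i\<le>R. sh (int i) x \<in> F"
    using syndetic[OF _ detF] nzF by blast
  obtain L' :: nat where L': "\<And>x p. x \<in> X \<Longrightarrow> 1 \<le> p \<Longrightarrow> p \<le> R \<Longrightarrow> \<not> agree (- int L') 0 x (sh (int p) x)"
    using no_short_repetition[of R] by blast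
  obtain N where N: "max (l + n) L' \<le> N" "complexity X (N + 1) \<le> complexity X N + K"
    using K by blast
  have card_le: "card (special_words N) \<le> K" using complexity_step[of N] N(2) by linarith
  have past: "y \<in> F" if "x \<in> X" "y \<in> X" "agree (- int N) 0 x y" "x \<in> F" for x y
    using Fpast[OF that(2-4)] N(1) by simp
  have rep: "\<not> agree (- int N) 0 x (sh (int p) x)" if "x \<in> X" "1 \<le> p" "p \<le> R" for x p
    using L'[OF that] N(1) agree_mono[of "- int N" 0 x "sh (int p) x" "- int L'" 0] by auto
  let ?E = "special N"
  define D where "D = {x \<in> X. sh (int n) x \<in> firsts F ?E}"
  have DX: "D \<subseteq> X" by (auto simp: D_def)
  \<comment> \<open>Any \<open>B + 1\<close> consecutive times contain a visit to \<open>?E\<close>,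
    so a visit to \<open>F\<close> more than \<open>B\<close> steps back is always separated by one;
    this gives the marked set a finite window.\<close>
  obtain B :: nat where B: "\<And>x. x \<in> X \<Longrightarrow> \<exists>i\<le>B. sh (int i) x \<in> ?E"
    using syndetic[OF special_subset determined_special special_nonempty] by blast
  have detG: "determined (int (N + B)) (firsts F ?E)"
  proof (rule determinedI)
    fix x y assume x: "x \<in> X" and y: "y \<in> X" and ag: "agree (- int (N + B)) (int (N + B)) x y"
      and G: "x \<in> firsts F ?E"
    have ags: "agree (- int N) 0 (sh (- q) x) (sh (- q) y)" if "0 \<le> q" "q \<le> int B" for q
      by (rule agree_sh[OF ag]) (use that in simp_all)
    have F: "sh (- q) y \<in> F \<longleftrightarrow> sh (- q) x \<in> F" if "0 \<le> q" "q \<le> int B" for q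
      using past[OF _ _ ags[OF that]] past[OF _ _ agree_sym[OF ags[OF that]]] x y by auto
    have "\<exists>q. 0 \<le> q \<and> q < p \<and> sh (- q) y \<in> ?E" if p: "1 \<le> p" "sh (- p) y \<in> F" for p
    proof (cases "p \<le> int B")
      case True
      then have "sh (- p) x \<in> F" using F p by simp
      then obtain q where q: "0 \<le> q" "q < p" "sh (- q) x \<in> ?E"
        using G p(1) unfolding firsts_def by blast
      then have "sh (- q) y \<in> ?E"
        using special_past[OF q(3) _ ags] True y by simp
      then show ?thesis using q by blast
    next
      case False
      obtain i where i: "i \<le> B" "sh (int i) (sh (- int B) y) \<in> ?E" using B[of "sh (- int B) y"] y by auto
      then show ?thesis using False by (intro exI[of _ "int B - int i"]) auto
    qed
    moreover have "y \<in> F" using F[of 0] G by (simp add: firsts_def)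
    ultimately show "y \<in> firsts F ?E" unfolding firsts_def by blast
  qed
  have detD: "determined (int (N + B) + int n) D"
  proof (rule determinedI)
    fix x y assume *: "x \<in> X" "y \<in> X" "agree (- (int (N + B) + int n)) (int (N + B) + int n) x y" "x \<in> D"
    have "sh (int n) x \<in> firsts F ?E \<longleftrightarrow> sh (int n) y \<in> firsts F ?E"
      by (rule determined_sh[OF detG *(1-3)]) simp_all
    then show "y \<in> D" using * by (simp add: D_def)
  qed
  have Dz: "agree (- int l) (int n) x z" if "x \<in> D" for x
  proof -
    have "agree (- int (l + n)) 0 (sh (int n) x) (sh (int n) z)"
      using that by (simp add: D_def firsts_def F_def)
    then show ?thesis by (simp add: agree_sh_iff)
  qed
  have "z \<in> D"
  proof -
    \<comment> \<open>A visit to \<open>F\<close> at most \<open>n\<close> steps earlier would give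
      a repetition of period at most \<open>n\<close> over length \<open>L\<close>; an older one is
      separated by the visit of \<open>z\<close> itself to \<open>?E\<close>, at
      \<open>q = n\<close>.\<close>
    have "\<exists>q. 0 \<le> q \<and> q < p \<and> sh (- q) (sh (int n) z) \<in> ?E"
      if p: "1 \<le> p" "sh (- p) (sh (int n) z) \<in> F" for p
    proof (cases "p \<le> int n")
      case True
      have "sh (int n) (sh (- p) z) \<in> F" using p(2) by (simp add: add.commute)
      then have "agree (- int l) (int n) (sh (- p) z) z" by (simp add: F_def agree_sh_iff del: sh_sh)
      then have "agree (- int L) 0 (sh (- p) z) z" by (rule agree_mono) (use l in simp_all)
      then have "agree (- int L) 0 (sh (- p) z) (sh (int (nat p)) (sh (- p) z))" using p by simp
      moreover have "1 \<le> nat p" "nat p \<le> n" "sh (- p) z \<in> X" using p True zX by auto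
      ultimately show ?thesis using L by blast
    next
      case False
      then show ?thesis using z by (intro exI[of _ "int n"]) simp
    qed
    then show ?thesis using nzF zX unfolding D_def firsts_def by blast
  qed
  moreover have "agree (- int n) (int n) x z" if "x \<in> D" for x
    by (rule agree_mono[OF Dz[OF that]]) (use l in simp_all)
  moreover have "sh (int p) x \<notin> D" if "x \<in> D" "1 \<le> p" "p \<le> n" for x p
  proof
    assume "sh (int p) x \<in> D"
    then have "agree (- int l) (int n) z (sh (int p) x)" by (rule agree_sym[OF Dz])
    with Dz[OF that(1)] have "agree (- int l) (int n) x (sh (int p) x)" by (rule agree_trans)
    then have "agree (- int L) 0 x (sh (int p) x)" by (rule agree_mono) (use l in simp_all)
    then show False using L that DX by blast
  qed
  moreover have "finite (return_word n D ` D) \<and> card (return_word n D ` D) \<le> K * (\<Sum>i\<le>K + 1. card A ^ i)"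
    by (rule card_return_words[OF D_def detD past R rep _ card_le]) (use N l in auto)
  ultimately show ?thesis
    by (intro exI[of _ D] exI[of _ "int (N + B) + int n"] conjI DX detD) simp_all
qed

lemma first_hit:
  assumes "D \<subseteq> X" "determined w D" "D \<noteq> {}" "x \<in> X"
  shows "sh (int (first_hit D x)) x \<in> D"
proof -
  obtain R :: nat where "\<forall>x\<in>X. \<exists>i\<le>R. sh (int i) x \<in> D" using syndetic[OF assms(1-3)] by blast
  then have "\<exists>j. sh (int j) x \<in> D" using assms(4) by blast
  then show ?thesis unfolding first_hit_def by (rule LeastI_ex)
qed

lemma first_hit_eq:
  assumes "y = sh (int j) x" "y \<in> D" "j < backtime D y"
  shows "first_hit D x = j"
  unfolding first_hit_def
proof (rule Least_equality)
  show "sh (int j) x \<in> D" using assms by simp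
  fix i assume i: "sh (int i) x \<in> D"
  show "j \<le> i"
  proof (rule ccontr)
    assume "\<not> j \<le> i"
    then have "sh (- int (j - i)) y \<notin> D" using assms(3) by (intro backtime_minimal) auto
    moreover have "sh (- int (j - i)) y = sh (int i) x" using assms(1) \<open>\<not> j \<le> i\<close> by (simp add: of_nat_diff)
    ultimately show False using i by simp
  qed
qed

text \<open>A backward return no longer than the first hit would itself be an earlier hit.\<close>

lemma first_hit_less_backtime:
  assumes "D \<subseteq> X" "determined w D" "D \<noteq> {}" "x \<in> X"
  shows "first_hit D x < backtime D (sh (int (first_hit D x)) x)"
proof (rule ccontr)
  let ?j = "first_hit D x" let ?h = "backtime D (sh (int ?j) x)"
  assume "\<not> ?j < ?h"
  have h: "1 \<le> ?h" "sh (- int ?h) (sh (int ?j) x) \<in> D"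
    using backtime_exists[OF assms(1-3)] assms(4) sh_in_iff by blast+
  then have "sh (int (?j - ?h)) x \<in> D" using \<open>\<not> ?j < ?h\<close> by (simp add: of_nat_diff)
  then have "?j \<le> ?j - ?h" unfolding first_hit_def by (rule Least_le)
  then show False using h(1) \<open>\<not> ?j < ?h\<close> by simp
qed

text \<open>The margins of the window allow membership in \<open>D\<close> to be compared at every
  backward step up to the return, so both points have the same return time; \<open>h\<close> may be
  any upper bound for it.\<close>

lemma return_word_cong:
  assumes D: "D \<subseteq> X" "determined w D" and x: "x \<in> D" "y \<in> X"
    and ag: "agree a b x y" and h: "backtime D x \<le> h"
    and ab: "a \<le> - int h - w" "a \<le> - int h - int n" "w \<le> b" "int n \<le> b"
  shows "y \<in> D \<and> return_word n D y = return_word n D x"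
proof -
  have xX: "x \<in> X" using D x by blast
  have mem: "sh (- int i) x \<in> D \<longleftrightarrow> sh (- int i) y \<in> D" if "i \<le> backtime D x" for i
    by (rule determined_sh[OF D(2) xX x(2) ag]) (use that h ab in auto)
  have bx: "1 \<le> backtime D x" "sh (- int (backtime D x)) x \<in> D"
    using backtime_exists[OF D _ xX] x by blast+
  have "backtime D y = backtime D x"
    using bx mem backtime_minimal[of _ D x] by (intro backtime_eqI) auto
  moreover have "agree (- int (backtime D x) - int n)
      (- int (backtime D x) - int n + int (backtime D x + 2 * n)) y x"
    by (rule agree_mono[OF agree_sym[OF ag]]) (use h ab in auto)
  ultimately have "return_word n D y = return_word n D x"
    unfolding return_word_def by (metis factor_eq_iff)
  then show ?thesis using mem[of 0] x by simp
qed

definition return_base :: "nat \<Rightarrow> (int \<Rightarrow> 'a) set \<Rightarrow> bool" where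
  "return_base n D \<longleftrightarrow> D \<subseteq> X \<and> (\<exists>w. determined w D) \<and> D \<noteq> {} \<and> finite (return_word n D ` D)"

section \<open>The Kakutani-Rohlin partition over a fixed base\<close>

context
  fixes n :: nat and D :: "(int \<Rightarrow> 'a) set"
  assumes rb: "return_base n D"
begin

private abbreviation "W \<equiv> return_word n D ` D"
private abbreviation "P \<equiv> return_towers n D"

lemma D_sub: "D \<subseteq> X" and D_ne: "D \<noteq> {}" and fin_W: "finite W"
  using rb by (auto simp: return_base_def)

lemma num_P: "num_towers P = card W"
  by (simp add: return_towers_def)

lemma enum_in: "k \<in> {1..num_towers P} \<Longrightarrow> enum W k \<in> W"
  using bij_enum[OF fin_W] unfolding num_P by (rule bij_betwE[rule_format])

lemma enum_onto: "u \<in> W \<Longrightarrow> \<exists>k\<in>{1..num_towers P}. enum W k = u"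
  using bij_enum[OF fin_W] unfolding num_P bij_betw_def by (metis imageE)

lemma enum_inj: "k \<in> {1..num_towers P} \<Longrightarrow> l \<in> {1..num_towers P} \<Longrightarrow> enum W k = enum W l \<Longrightarrow> k = l"
  using bij_enum[OF fin_W] unfolding num_P bij_betw_def inj_on_def by blast

lemma base_P: "x \<in> base P k \<longleftrightarrow> x \<in> D \<and> return_word n D x = enum W k"
  by (simp add: return_towers_def)

lemma height_P: "x \<in> base P k \<Longrightarrow> height P k = backtime D x"
proof -
  assume "x \<in> base P k"
  then have "length (enum W k) = length (return_word n D x)" by (simp add: base_P)
  then show ?thesis by (simp add: return_towers_def return_word_def)
qed

lemma base_P_nonempty: "k \<in> {1..num_towers P} \<Longrightarrow> base P k \<noteq> {}"
  using enum_in[of k] base_P by fastforce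

lemma backtime_D: "x \<in> D \<Longrightarrow> 1 \<le> backtime D x \<and> sh (- int (backtime D x)) x \<in> D"
  using backtime_exists rb D_sub unfolding return_base_def by blast

lemma height_P_pos: "k \<in> {1..num_towers P} \<Longrightarrow> 1 \<le> height P k"
  using base_P_nonempty height_P backtime_D base_P by (metis all_not_in_conv)

lemma determined_base_P: "\<exists>w. determined w (base P k)"
proof -
  obtain w where w: "determined w D" using rb by (auto simp: return_base_def)
  define v where "v = int (height P k) + \<bar>w\<bar> + int n"
  have "determined v (base P k)"
  proof (rule determinedI)
    fix x y assume *: "x \<in> X" "y \<in> X" "agree (- v) v x y" "x \<in> base P k"
    have xD: "x \<in> D" using *(4) base_P by blast
    have h: "backtime D x \<le> height P k" using height_P[OF *(4)] by simp
    have "y \<in> D \<and> return_word n D y = return_word n D x"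
      by (rule return_word_cong[OF D_sub w xD *(2,3) h]) (auto simp: v_def)
    then show "y \<in> base P k" using *(4) base_P by simp
  qed
  then show ?thesis by blast
qed

lemma level_P: "x \<in> level M shift P k j \<longleftrightarrow> x \<in> X \<and> sh (int j) x \<in> base P k"
  by (simp add: level_def shift_funpow)

lemma determined_level_P: "\<exists>w. determined w (level M shift P k j)"
proof -
  obtain w where w: "determined w (base P k)" using determined_base_P by blast
  have "determined (w + int j) (level M shift P k j)"
  proof (rule determinedI)
    fix x y assume *: "x \<in> X" "y \<in> X" "agree (- (w + int j)) (w + int j) x y" "x \<in> level M shift P k j"
    have "sh (int j) x \<in> base P k \<longleftrightarrow> sh (int j) y \<in> base P k"
      by (rule determined_sh[OF w *(1-3)]) simp_all
    then show "y \<in> level M shift P k j" using * by (simp add: level_P)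
  qed
  then show ?thesis by blast
qed

text \<open>A point of a tower first meets \<open>D\<close> at the base of that tower, so its level
  index is intrinsic; disjointness of the levels rests on this.\<close>

lemma level_first_hit:
  assumes "x \<in> level M shift P k j" "j < height P k"
  shows "first_hit D x = j"
  using assms first_hit_eq[OF refl, of j x D] height_P by (auto simp: level_P base_P)

lemma level_exists:
  assumes "x \<in> X"
  shows "\<exists>k\<in>{1..num_towers P}. first_hit D x < height P k \<and> x \<in> level M shift P k (first_hit D x)"
proof -
  obtain w where w: "determined w D" using rb by (auto simp: return_base_def)
  have hit: "sh (int (first_hit D x)) x \<in> D" by (rule first_hit[OF D_sub w D_ne assms])
  then obtain k where k: "k \<in> {1..num_towers P}" "enum W k = return_word n D (sh (int (first_hit D x)) x)"
    using enum_onto by blast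
  then have b: "sh (int (first_hit D x)) x \<in> base P k" using hit by (simp add: base_P)
  have "first_hit D x < height P k"
    using first_hit_less_backtime[OF D_sub w D_ne assms] height_P[OF b] by simp
  moreover have "x \<in> level M shift P k (first_hit D x)" using b assms by (simp add: level_P)
  ultimately show ?thesis using k(1) by blast
qed

lemma full_base_P: "full_base P = D"
proof
  show "D \<subseteq> full_base P"
  proof
    fix x assume x: "x \<in> D"
    then obtain k where "k \<in> {1..num_towers P}" "enum W k = return_word n D x"
      using enum_onto by blast
    moreover from this have "x \<in> base P k" using x by (simp add: base_P)
    ultimately show "x \<in> full_base P" unfolding full_base_def by blast
  qed
qed (auto simp: full_base_def base_P)

lemma levels_P: "levels M shift P = {level M shift P k j | k j. k \<in> {1..num_towers P} \<and> j < height P k}"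
  unfolding levels_def level_indices_def by force

lemma level_nonempty: "k \<in> {1..num_towers P} \<Longrightarrow> level M shift P k j \<noteq> {}"
proof -
  assume "k \<in> {1..num_towers P}"
  then obtain y where y: "y \<in> base P k" using base_P_nonempty by blast
  then have "sh (- int j) y \<in> level M shift P k j" using D_sub by (auto simp: level_P base_P)
  then show ?thesis by blast
qed

lemma level_inj:
  assumes "x \<in> level M shift P k j" "k \<in> {1..num_towers P}" "j < height P k"
    and "x \<in> level M shift P l i" "l \<in> {1..num_towers P}" "i < height P l"
  shows "k = l \<and> j = i"
proof -
  have "j = i" using level_first_hit[OF assms(1,3)] level_first_hit[OF assms(4,6)] by simp
  moreover from this have "enum W k = enum W l"
    using assms(1,4) unfolding level_P base_P by simp
  ultimately show ?thesis using enum_inj[OF assms(2,5)] by blast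
qed

lemma ckr_partition_P: "ckr_partition M shift P"
  unfolding ckr_partition_def
proof (intro conjI ballI)
  fix k assume k: "k \<in> {1..num_towers P}"
  have sub: "base P k \<subseteq> X" using D_sub by (auto simp: base_P)
  obtain w where "determined w (base P k)" using determined_base_P by blast
  then show "openin M (base P k)" "closedin M (base P k)"
    using determined_openin determined_closedin sub by blast+
  show "1 \<le> height P k" by (rule height_P_pos[OF k])
next
  show "inj_on (\<lambda>(k, j). level M shift P k j) (level_indices P)"
  proof (rule inj_onI)
    fix a b
    assume ab: "a \<in> level_indices P" "b \<in> level_indices P"
      "(\<lambda>(k, j). level M shift P k j) a = (\<lambda>(k, j). level M shift P k j) b"
    obtain k j l i where kl: "a = (k, j)" "b = (l, i)" by (cases a, cases b)
    have *: "(k, j) \<in> level_indices P" "(l, i) \<in> level_indices P"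
      "level M shift P k j = level M shift P l i"
      using ab by (simp_all add: kl)
    then have "k \<in> {1..num_towers P}" by (simp add: level_indices_def)
    then obtain x where "x \<in> level M shift P k j" using level_nonempty by blast
    then show "a = b" using * level_inj[of x k j l i] by (auto simp: level_indices_def kl)
  qed
next
  show "partition_on (topspace M) (levels M shift P)"
  proof (rule partition_onI)
    show "\<Union> (levels M shift P) = topspace M"
    proof
      show "topspace M \<subseteq> \<Union> (levels M shift P)"
        unfolding topspace_M using level_exists unfolding levels_P by blast
    qed (auto simp: levels_P level_P)
    show "disjnt p q" if "p \<in> levels M shift P" "q \<in> levels M shift P" "p \<noteq> q" for p q
      using that level_inj unfolding levels_P disjnt_iff by blast
    show "{} \<notin> levels M shift P"
      using level_nonempty unfolding levels_P by blast
  qed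
next
  show "(\<Union>k\<in>{1..num_towers P}. level M shift P k (height P k)) = full_base P"
    unfolding full_base_P
  proof
    show "(\<Union>k\<in>{1..num_towers P}. level M shift P k (height P k)) \<subseteq> D"
    proof
      fix x assume "x \<in> (\<Union>k\<in>{1..num_towers P}. level M shift P k (height P k))"
      then obtain k where k: "sh (int (height P k)) x \<in> base P k" by (auto simp: level_P)
      define y where "y = sh (int (height P k)) x"
      have "y \<in> D" "height P k = backtime D y" using k height_P base_P unfolding y_def by blast+
      then have "sh (- int (height P k)) y \<in> D" using backtime_D by metis
      then show "x \<in> D" by (simp add: y_def)
    qed
    show "D \<subseteq> (\<Union>k\<in>{1..num_towers P}. level M shift P k (height P k))"
    proof
      fix x assume x: "x \<in> D"
      obtain w where w: "determined w D" using rb by (auto simp: return_base_def)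
      \<comment> \<open>Starting one step later makes the next visit to \<open>D\<close> a genuine
        return; it takes \<open>Suc j\<close> steps from \<open>x\<close>, which is the height of
        the tower concerned.\<close>
      define y where "y = sh 1 x"
      define j where "j = first_hit D y"
      have yX: "y \<in> X" using x D_sub by (auto simp: y_def)
      obtain k where k: "k \<in> {1..num_towers P}" "j < height P k" "sh (int j) y \<in> base P k"
        using level_exists[OF yX] unfolding j_def level_P by blast
      define v where "v = sh (int j) y"
      have v: "v = sh (int (Suc j)) x" by (simp add: v_def y_def add.commute)
      have "backtime D v = Suc j"
      proof (rule backtime_eqI)
        show "sh (- int (Suc j)) v \<in> D" using x by (simp add: v)
        fix i assume "1 \<le> i" "i < Suc j"
        then have "i < backtime D v" using k height_P[OF k(3)] by (simp add: v_def)
        then show "sh (- int i) v \<notin> D" using \<open>1 \<le> i\<close> backtime_minimal by blast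
      qed simp
      then have "height P k = Suc j" using height_P[OF k(3)] by (simp add: v_def)
      moreover have "sh (int (Suc j)) x \<in> base P k" using k(3) unfolding v[symmetric] v_def .
      ultimately have "x \<in> level M shift P k (height P k)" using x D_sub by (auto simp: level_P)
      then show "x \<in> (\<Union>k\<in>{1..num_towers P}. level M shift P k (height P k))" using k(1) by blast
    qed
  qed
qed

text \<open>Seen from level \<open>j\<close>, the window shared by the return words is moved by
  \<open>j\<close>, which lies between \<open>0\<close> and the height, so its margins still cover
  radius \<open>n\<close>.\<close>

lemma level_agree:
  assumes "x \<in> level M shift P k j" "y \<in> level M shift P k j" "j < height P k"
  shows "agree (- int n) (int n) x y"
proof -
  define u v where "u = sh (int j) x" and "v = sh (int j) y"
  have uv: "u \<in> base P k" "v \<in> base P k" using assms by (auto simp: level_P u_def v_def)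
  then have "return_word n D u = return_word n D v" by (simp add: base_P)
  then have "agree (- int (backtime D u) - int n) (int n) u v" by (rule return_word_eq_imp_agree)
  then have "agree (- int (height P k) - int n) (int n) u v" using height_P[OF uv(1)] by simp
  then have "agree (- int (height P k) - int n + int j) (int n + int j) x y"
    unfolding u_def v_def agree_sh_iff .
  then show ?thesis by (rule agree_mono) (use assms(3) in simp_all)
qed

lemma height_gt:
  assumes "\<forall>x\<in>D. \<forall>p::nat. 1 \<le> p \<and> p \<le> m \<longrightarrow> sh (int p) x \<notin> D" "k \<in> {1..num_towers P}"
  shows "m < height P k"
proof (rule ccontr)
  assume "\<not> m < height P k"
  obtain y where y: "y \<in> base P k" using base_P_nonempty[OF assms(2)] by blast
  then have h: "height P k = backtime D y" "y \<in> D" using height_P base_P by blast+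
  then have "sh (- int (height P k)) y \<in> D" "1 \<le> height P k" using backtime_D by simp_all
  then have "sh (int (height P k)) (sh (- int (height P k)) y) \<notin> D"
    using assms(1) \<open>\<not> m < height P k\<close> by (metis not_less)
  then show False using h by simp
qed

lemma uniform_return:
  "\<exists>R::nat. \<forall>k\<in>{1..num_towers P}. height P k \<le> R \<and> (\<forall>x\<in>X. \<exists>i\<le>R. sh (int i) x \<in> base P k)"
proof -
  have "\<exists>R::nat. \<forall>x\<in>X. \<exists>i\<le>R. sh (int i) x \<in> base P k" if "k \<in> {1..num_towers P}" for k
  proof -
    obtain w where "determined w (base P k)" using determined_base_P by blast
    moreover have "base P k \<subseteq> X" using D_sub by (auto simp: base_P)
    ultimately show ?thesis using syndetic base_P_nonempty[OF that] by blast
  qed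
  then obtain r :: "nat \<Rightarrow> nat" where r: "\<And>k. k \<in> {1..num_towers P} \<Longrightarrow> \<forall>x\<in>X. \<exists>i\<le>r k. sh (int i) x \<in> base P k"
    by metis
  define R where "R = (\<Sum>k\<in>{1..num_towers P}. r k + height P k)"
  have "r k + height P k \<le> R" if "k \<in> {1..num_towers P}" for k
    unfolding R_def by (rule member_le_sum[OF that]) simp_all
  then show ?thesis using r by (intro exI[of _ R]) (meson add_leD1 add_leD2 order_trans)
qed

end

text \<open>After a delay of \<open>R\<close> steps the base of tower \<open>l\<close> is met within
  \<open>R\<close> further steps, and the delay leaves room for all of tower \<open>l\<close> before
  that visit. This fits into \<open>2 * R + 1\<close> levels, fewer than the height of tower
  \<open>k\<close>.\<close>

lemma return_towers_cross:
  assumes P: "return_base n D" and Q: "return_base m C"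
    and R: "\<forall>k\<in>{1..num_towers (return_towers n D)}. height (return_towers n D) k \<le> R \<and>
        (\<forall>x\<in>X. \<exists>i\<le>R. sh (int i) x \<in> base (return_towers n D) k)"
    and sep: "\<forall>x\<in>C. \<forall>p::nat. 1 \<le> p \<and> p \<le> m \<longrightarrow> sh (int p) x \<notin> C" and m: "2 * R + 1 \<le> m"
    and k: "k \<in> {1..num_towers (return_towers m C)}" and l: "l \<in> {1..num_towers (return_towers n D)}"
  shows "crosses M shift (return_towers m C) k (return_towers n D) l"
  unfolding crosses_def
proof
  let ?P = "return_towers n D" and ?Q = "return_towers m C"
  fix x assume "x \<in> level M shift ?Q k (height ?Q k - 1)"
  then have xX: "x \<in> X" by (simp add: level_P[OF Q])
  obtain i0 where i0: "i0 \<le> R" "sh (int i0) (sh (int R) x) \<in> base ?P l"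
    using R l xX sh_in_iff by blast
  have h: "1 \<le> height ?P l" "height ?P l \<le> R" using height_P_pos[OF P l] R l by auto
  \<comment> \<open>The visit to the base at time \<open>i0 + R\<close> is the last of the
    \<open>height ?P l\<close> times of the crossing; hence the \<open>+ 1\<close>.\<close>
  define i where "i = i0 + R + 1 - height ?P l"
  have ih: "i + height ?P l = i0 + R + 1" using h by (simp add: i_def)
  have "m < height ?Q k" by (rule height_gt[OF Q sep k])
  then have "i + height ?P l \<le> height ?Q k" using ih i0 m by simp
  moreover have "(shift ^^ (i + j)) x \<in> level M shift ?P l (height ?P l - 1 - j)" if "j < height ?P l" for j
  proof -
    have "int (height ?P l - 1 - j) + int (i + j) = int i0 + int R" using ih that by linarith
    then have "sh (int (height ?P l - 1 - j)) (sh (int (i + j)) x) \<in> base ?P l" using i0(2) by (metis sh_sh)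
    then show ?thesis unfolding shift_funpow level_P[OF P] using xX by simp
  qed
  ultimately show "\<exists>i. i + height ?P l \<le> height ?Q k \<and>
      (\<forall>j<height ?P l. (shift ^^ (i + j)) x \<in> level M shift ?P l (height ?P l - 1 - j))"
    by blast
qed

text \<open>Points of one finer level agree along the whole tower and \<open>m\<close> letters
  beyond on both sides. As \<open>C \<subseteq> D\<close>, the next visit to \<open>D\<close> and
  the one preceding it lie between two consecutive visits to \<open>C\<close>, so the agreement
  determines the coarser level.\<close>

lemma return_towers_refine:
  assumes P: "return_base n D" and Q: "return_base m C"
    and nm: "n \<le> m" "determined (int m) D" "C \<subseteq> D"
    and U: "U \<in> levels M shift (return_towers m C)"
  shows "\<exists>V\<in>levels M shift (return_towers n D). U \<subseteq> V"
proof -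
  let ?P = "return_towers n D" and ?Q = "return_towers m C"
  have DX: "D \<subseteq> X" by (rule D_sub[OF P])
  obtain k' j' where k': "k' \<in> {1..num_towers ?Q}" "j' < height ?Q k'" "U = level M shift ?Q k' j'"
    using U unfolding levels_P[OF Q] by blast
  obtain x0 where x0: "x0 \<in> U" using level_nonempty[OF Q k'(1)] k'(3) by blast
  have x0X: "x0 \<in> X" using x0 k' by (simp add: level_P[OF Q])
  define j where "j = first_hit D x0"
  obtain k where k: "k \<in> {1..num_towers ?P}" "j < height ?P k" "x0 \<in> level M shift ?P k j"
    using level_exists[OF P x0X] unfolding j_def by blast
  have "U \<subseteq> level M shift ?P k j"
  proof
    fix x assume x: "x \<in> U"
    have xX: "x \<in> X" using x k' by (simp add: level_P[OF Q])
    define y0 y where "y0 = sh (int j') x0" and "y = sh (int j') x"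
    have b: "y0 \<in> base ?Q k'" "y \<in> base ?Q k'"
      using x x0 k' by (auto simp: level_P[OF Q] y0_def y_def)
    define h where "h = backtime C y0"
    have h: "height ?Q k' = h" unfolding h_def by (rule height_P[OF Q b(1)])
    have y0C: "y0 \<in> C" using b base_P[OF Q] by blast
    have "return_word m C y0 = return_word m C y" using b base_P[OF Q] by simp
    then have ag: "agree (- int h - int m) (int m) y0 y" unfolding h_def by (rule return_word_eq_imp_agree)
    have jj: "j \<le> j'" unfolding j_def first_hit_def
      by (rule Least_le) (use y0C nm in \<open>auto simp: y0_def\<close>)
    define v0 v where "v0 = sh (int j) x0" and "v = sh (int j) x"
    have v: "v0 = sh (int j - int j') y0" "v = sh (int j - int j') y"
      by (simp_all add: v0_def v_def y0_def y_def)
    have agv: "agree (- int h - int m - (int j - int j')) (int m - (int j - int j')) v0 v"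
      unfolding v agree_sh_iff using ag by simp
    have v0D: "v0 \<in> D" using k(3) by (simp add: level_P[OF P] base_P[OF P] v0_def)
    have j'h: "j' < h" using k' h by simp
    \<comment> \<open>The preceding visit to \<open>C\<close> is also a visit to \<open>D\<close>
      and so bounds the backward return time.\<close>
    have bt: "backtime D v0 \<le> h - (j' - j)"
      unfolding backtime_def
    proof (rule Least_le)
      have "sh (- int h) y0 \<in> C" using backtime_D[OF Q y0C] by (simp add: h_def)
      moreover have "sh (- int (h - (j' - j))) v0 = sh (- int h) y0"
        using jj j'h by (simp add: v of_nat_diff)
      ultimately show "1 \<le> h - (j' - j) \<and> sh (- int (h - (j' - j))) v0 \<in> D"
        using jj j'h nm(3) by auto
    qed
    have "v \<in> D \<and> return_word n D v = return_word n D v0"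
      by (rule return_word_cong[OF DX nm(2) v0D _ agv bt])
        (use xX nm(1) jj j'h in \<open>auto simp: v_def of_nat_diff\<close>)
    then show "x \<in> level M shift ?P k j"
      using k(3) xX by (simp add: level_P[OF P] base_P[OF P] v_def v0_def)
  qed
  then show ?thesis using k unfolding levels_P[OF P] by blast
qed

section \<open>The primitive nested sequence of partitions\<close>

definition trivial_towers :: "(int \<Rightarrow> 'a) towers" where
  "trivial_towers = \<lparr> num_towers = 1, base = (\<lambda>_. X), height = (\<lambda>_. 1) \<rparr>"

lemma levels_trivial: "levels M shift trivial_towers = {X}"
proof -
  have "level_indices trivial_towers = {(1, 0)}"
    by (auto simp: level_indices_def trivial_towers_def)
  then show ?thesis by (simp add: levels_def level_def trivial_towers_def)
qed

lemma full_base_trivial: "full_base trivial_towers = X"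
  by (simp add: full_base_def trivial_towers_def)

lemma ckr_partition_trivial: "ckr_partition M shift trivial_towers"
proof -
  have ix: "level_indices trivial_towers = {(1, 0)}"
    by (auto simp: level_indices_def trivial_towers_def)
  have "openin M X" "closedin M X"
    using openin_topspace[of M] closedin_topspace[of M] unfolding topspace_M by blast+
  moreover have "X \<noteq> {}" using inf by auto
  ultimately show ?thesis
    unfolding ckr_partition_def levels_trivial full_base_trivial ix
    by (auto simp: trivial_towers_def level_def shift_eq_sh partition_on_def)
qed

theorem rank_at_most_of_complexity:
  assumes K: "\<And>N0. \<exists>N\<ge>N0. complexity X (N + 1) \<le> complexity X N + K"
  shows "rank_at_most M shift (K * (\<Sum>i\<le>K + 1. card A ^ i))"
proof -
  let ?d = "K * (\<Sum>i\<le>K + 1. card A ^ i)"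
  obtain z where z: "\<And>N. z \<in> special N" using ex_special_all by blast
  have zX: "z \<in> X" using z special_subset by blast
  define good where "good n D \<longleftrightarrow> return_base n D \<and> z \<in> D \<and> (\<forall>x\<in>D. agree (- int n) (int n) x z) \<and>
    (\<forall>x\<in>D. \<forall>p::nat. 1 \<le> p \<and> p \<le> n \<longrightarrow> sh (int p) x \<notin> D) \<and> card (return_word n D ` D) \<le> ?d" for n D
  have good: "\<exists>D. good n D" for n
    using ex_good_base[OF z K, of n] unfolding good_def return_base_def by blast
  obtain s where s: "\<And>i. i \<le> fst (s i) \<and> good (fst (s i)) (snd (s i))"
    and step: "\<And>i. fst (s i) \<le> fst (s (Suc i)) \<and> determined (int (fst (s (Suc i)))) (snd (s i))"
  proof -
    have "\<exists>s. \<forall>i. (i \<le> fst (s i) \<and> good (fst (s i)) (snd (s i))) \<and>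
        (fst (s i) \<le> fst (s (Suc i)) \<and> determined (int (fst (s (Suc i)))) (snd (s i)))"
    proof (rule dependent_nat_choice[where P = "\<lambda>i q. i \<le> fst q \<and> good (fst q) (snd q)" and
          Q = "\<lambda>i q q'. fst q \<le> fst q' \<and> determined (int (fst q')) (snd q)"])
      show "\<exists>q. 0 \<le> fst q \<and> good (fst q) (snd q)" using good[of 0] by auto
    next
      fix q :: "nat \<times> (int \<Rightarrow> 'a) set" and i
      assume "i \<le> fst q \<and> good (fst q) (snd q)"
      then obtain w where w: "determined w (snd q)" by (auto simp: good_def return_base_def)
      \<comment> \<open>The next radius is at least the window of the present base. The next base
        lies in the cylinder of \<open>z\<close> of that radius, and \<open>z\<close> lies in the
        present base, so the bases will be nested.\<close>
      define n where "n = Max {fst q, Suc i, nat w}"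
      have n: "fst q \<le> n" "Suc i \<le> n" "nat w \<le> n" by (auto simp: n_def)
      obtain D where "good n D" using good by blast
      moreover have "determined (int n) (snd q)" using determined_mono[OF w] n by simp
      ultimately show "\<exists>q'. (Suc i \<le> fst q' \<and> good (fst q') (snd q')) \<and>
          fst q \<le> fst q' \<and> determined (int (fst q')) (snd q)"
        using n by (intro exI[of _ "(n, D)"]) simp
    qed
    then show ?thesis using that by blast
  qed
  define n D where "n = (\<lambda>i. fst (s i))" and "D = (\<lambda>i. snd (s i))"
  have rb: "return_base (n i) (D i)" and zD: "z \<in> D i" and cyl: "\<And>x. x \<in> D i \<Longrightarrow> agree (- int (n i)) (int (n i)) x z"
    and sep: "\<forall>x\<in>D i. \<forall>p::nat. 1 \<le> p \<and> p \<le> n i \<longrightarrow> sh (int p) x \<notin> D i"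
    and card: "card (return_word (n i) (D i) ` D i) \<le> ?d" and n_ge: "i \<le> n i" for i
    using s[of i] unfolding good_def n_def D_def by blast+
  have n_mono: "n i \<le> n (Suc i)" and det: "determined (int (n (Suc i))) (D i)" for i
    using step[of i] unfolding n_def D_def by blast+
  have sub: "D (Suc i) \<subseteq> D i" for i
  proof
    fix x assume x: "x \<in> D (Suc i)"
    then have "x \<in> X" using D_sub[OF rb] by blast
    then show "x \<in> D i"
      using det[of i] zD[of i] zX agree_sym[OF cyl[OF x]] unfolding determined_def by blast
  qed
  define P where "P i = (case i of 0 \<Rightarrow> trivial_towers | Suc i \<Rightarrow> return_towers (n i) (D i))" for i
  have P0: "P 0 = trivial_towers" and PS: "P (Suc i) = return_towers (n i) (D i)" for i
    by (simp_all add: P_def)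
  have fb: "full_base (P (Suc i)) = D i" for i unfolding PS by (rule full_base_P[OF rb])
  have lev: "U \<subseteq> X" if "U \<in> levels M shift (P (Suc i))" for U i
    using that unfolding PS levels_P[OF rb] by (auto simp: level_P[OF rb])
  have ckr: "ckr_partition M shift (P i)" for i
    by (cases i) (simp_all add: P0 PS ckr_partition_trivial ckr_partition_P[OF rb])
  have base_dec: "full_base (P (Suc i)) \<subseteq> full_base (P i)" for i
  proof (cases i)
    case 0
    then show ?thesis using D_sub[OF rb] by (simp add: fb P0 full_base_trivial)
  qed (use sub fb in simp)
  have refine: "\<exists>V\<in>levels M shift (P i). U \<subseteq> V" if "U \<in> levels M shift (P (Suc i))" for U i
  proof (cases i)
    case 0
    then show ?thesis using lev[OF that] by (simp add: P0 levels_trivial)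
  next
    case (Suc j)
    show ?thesis
      using return_towers_refine[OF rb rb n_mono det sub] that unfolding Suc PS by blast
  qed
  have inter: "(\<Inter>i. full_base (P i)) = {z}"
  proof
    show "{z} \<subseteq> (\<Inter>i. full_base (P i))"
    proof -
      have "z \<in> full_base (P i)" for i
        by (cases i) (use zX zD fb in \<open>simp_all add: P0 full_base_trivial\<close>)
      then show ?thesis by blast
    qed
    show "(\<Inter>i. full_base (P i)) \<subseteq> {z}"
    proof
      fix x assume "x \<in> (\<Inter>i. full_base (P i))"
      then have xD: "x \<in> D i" for i using fb by blast
      have "x k = z k" for k
      proof (rule agreeD[OF cyl[OF xD]])
        have "nat \<bar>k\<bar> + 1 \<le> n (nat \<bar>k\<bar> + 1)" by (rule n_ge)
        then show "- int (n (nat \<bar>k\<bar> + 1)) \<le> k" "k < int (n (nat \<bar>k\<bar> + 1))" by linarith+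
      qed
      then show "x \<in> {z}" by auto
    qed
  qed
  have span: "topology_generated_by (\<Union>i. levels M shift (P i)) = M"
  proof -
    let ?L = "\<Union>i. levels M shift (P i)"
    have open_L: "openin M V" if V: "V \<in> ?L" for V
    proof -
      obtain i where i: "V \<in> levels M shift (P i)" using V by blast
      show ?thesis
      proof (cases i)
        case 0
        then have "V = topspace M" using i unfolding topspace_M by (simp add: P0 levels_trivial)
        then show ?thesis by (simp only: openin_topspace)
      next
        case (Suc j)
        have VX: "V \<subseteq> X" using i lev unfolding Suc by blast
        obtain k l where "V = level M shift (return_towers (n j) (D j)) k l"
          using i unfolding Suc PS levels_P[OF rb] by blast
        then obtain w where "determined w V" using determined_level_P[OF rb] by blast
        then show ?thesis by (rule determined_openin[OF VX])
      qed
    qed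
    have "openin (topology_generated_by ?L) U \<longleftrightarrow> openin M U" for U
    proof
      assume "openin (topology_generated_by ?L) U"
      then have "generate_topology_on ?L U" by (rule openin_topology_generated_by)
      then show "openin M U"
        by (rule generate_topology_on_coarsest[OF istopology_openin _, rotated]) (rule open_L)
    next
      assume U: "openin M U"
      have "\<exists>V\<in>?L. x \<in> V \<and> V \<subseteq> U" if x: "x \<in> U" for x
      proof -
        have xX: "x \<in> X" using U x unfolding openin_M_iff by blast
        obtain w where w: "\<And>y. y \<in> X \<Longrightarrow> agree (- w) w x y \<Longrightarrow> y \<in> U"
          using U x unfolding openin_M_iff by blast
        define i where "i = nat w"
        define Q where "Q = return_towers (n i) (D i)"
        obtain k where k: "k \<in> {1..num_towers Q}" "first_hit (D i) x < height Q k"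
          "x \<in> level M shift Q k (first_hit (D i) x)"
          using level_exists[OF rb xX] unfolding Q_def by blast
        let ?V = "level M shift Q k (first_hit (D i) x)"
        have "?V \<in> levels M shift (P (Suc i))"
          using k unfolding PS levels_P[OF rb] Q_def by blast
        moreover have "?V \<subseteq> U"
        proof
          fix y assume y: "y \<in> ?V"
          have "agree (- int (n i)) (int (n i)) x y"
            using level_agree[OF rb] k y unfolding Q_def by blast
          then have "agree (- w) w x y" by (rule agree_mono) (use n_ge[of i] in \<open>auto simp: i_def\<close>)
          moreover have "y \<in> X" using y by (simp add: Q_def level_P[OF rb])
          ultimately show "y \<in> U" using w by blast
        qed
        ultimately show ?thesis using k(3) by blast
      qed
      then have "U = \<Union> {V \<in> ?L. V \<subseteq> U}" by blast
      moreover have "openin (topology_generated_by ?L) (\<Union> {V \<in> ?L. V \<subseteq> U})"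
        by (rule openin_Union) (auto intro: topology_generated_by_Basis)
      ultimately show "openin (topology_generated_by ?L) U" by simp
    qed
    then show ?thesis by (simp add: topology_eq)
  qed
  have "nested_ckr M shift P"
    unfolding nested_ckr_def
    using ckr base_dec refine inter span by (auto simp: P0 levels_trivial)
  moreover have "primitive_ckr M shift P"
    unfolding primitive_ckr_def
  proof (intro allI impI)
    fix i :: nat assume "1 \<le> i"
    then obtain j where j: "i = Suc j" by (cases i) auto
    obtain R where R: "\<forall>k\<in>{1..num_towers (return_towers (n j) (D j))}. height (return_towers (n j) (D j)) k \<le> R \<and>
        (\<forall>x\<in>X. \<exists>i\<le>R. sh (int i) x \<in> base (return_towers (n j) (D j)) k)"
      using uniform_return[OF rb] by blast
    \<comment> \<open>The return times to the base of \<open>P (Suc N)\<close> exceed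
      \<open>n N\<close>, which is at least \<open>2 * R + 1\<close>; adding \<open>i\<close> makes
      \<open>Suc N\<close> exceed \<open>i\<close>.\<close>
    define N where "N = 2 * R + 1 + i"
    have "crosses M shift (P (Suc N)) k (P i) l"
      if "k \<in> {1..num_towers (P (Suc N))}" "l \<in> {1..num_towers (P i)}" for k l
      unfolding j PS
      by (rule return_towers_cross[OF rb rb R sep])
        (use that n_ge[of N] in \<open>auto simp: j PS N_def\<close>)
    then show "\<exists>N>i. \<forall>k\<in>{1..num_towers (P N)}. \<forall>l\<in>{1..num_towers (P i)}. crosses M shift (P N) k (P i) l"
      by (intro exI[of _ "Suc N"]) (auto simp: N_def)
  qed
  moreover have "num_towers (P i) \<le> ?d" for i
  proof (cases i)
    case 0
    \<comment> \<open>The trivial partition has one tower, so the bound must be at least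
      \<open>1\<close>; it is, because it bounds a nonempty set of return words.\<close>
    have "card (return_word (n 0) (D 0) ` D 0) \<noteq> 0"
      using rb[of 0] zD[of 0] unfolding return_base_def by auto
    then have "1 \<le> ?d" using card[of 0] by linarith
    then show ?thesis by (simp add: 0 P0 trivial_towers_def)
  next
    case (Suc j)
    then show ?thesis using card[of j] by (simp add: PS num_P[OF rb])
  qed
  ultimately show ?thesis unfolding rank_at_most_def by blast
qed

end

subsection \<open>The bound on the topological rank\<close>

lemma sum_powers_le: "(\<Sum>i\<le>n. a ^ i) \<le> (1 + a :: nat) ^ n"
proof (induction n)
  case (Suc n)
  have "(\<Sum>i\<le>Suc n. a ^ i) \<le> (1 + a) ^ n + a * a ^ n" using Suc by simp
  also have "\<dots> \<le> (1 + a) ^ n + a * (1 + a) ^ n" by (intro add_left_mono mult_left_mono power_mono) simp_all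
  finally show ?case by simp
qed simp

text \<open>For \<open>K \<ge> 1\<close> the number \<open>b\<close> dominates both \<open>K\<close>
  and \<open>1 + a\<close>, so the left side is at most \<open>b ^ (K + 2)\<close>; for
  \<open>K = 0\<close> it is \<open>0\<close>.\<close>

lemma rank_bound:
  fixes a K :: nat and K1 :: real
  assumes "1 \<le> a" "real K \<le> K1"
  shows "real (K * (\<Sum>i\<le>K + 1. a ^ i)) \<le> (1 + (real a)\<^sup>2 * K1\<^sup>2) powr (2 * (K1 + 2))"
proof (cases "K = 0")
  case False
  define b where "b = 1 + a\<^sup>2 * K\<^sup>2"
  have "1 \<le> a\<^sup>2 * K" "1 \<le> a * K\<^sup>2"
    using assms(1) False by (simp_all add: Suc_le_eq)
  then have "K * 1 \<le> K * (a\<^sup>2 * K)" "a * 1 \<le> a * (a * K\<^sup>2)"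
    by (intro mult_left_mono; simp)+
  moreover have "K * (a\<^sup>2 * K) = a\<^sup>2 * K\<^sup>2" "a * (a * K\<^sup>2) = a\<^sup>2 * K\<^sup>2"
    by (simp_all add: power2_eq_square)
  ultimately have K: "K \<le> b" and a: "1 + a \<le> b" by (simp_all add: b_def)
  have "K * (\<Sum>i\<le>K + 1. a ^ i) \<le> K * (1 + a) ^ (K + 1)"
    by (intro mult_left_mono sum_powers_le) simp
  also have "\<dots> \<le> b * b ^ (K + 1)"
    by (intro mult_mono power_mono K a) simp_all
  finally have "K * (\<Sum>i\<le>K + 1. a ^ i) \<le> b ^ (K + 2)" by simp
  then have "real (K * (\<Sum>i\<le>K + 1. a ^ i)) \<le> real b ^ (K + 2)"
    by (metis of_nat_le_iff of_nat_power)
  also have "\<dots> \<le> (1 + (real a)\<^sup>2 * K1\<^sup>2) ^ (K + 2)"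
    using assms(2) by (intro power_mono) (auto simp: b_def intro!: mult_left_mono power_mono)
  also have "\<dots> = (1 + (real a)\<^sup>2 * K1\<^sup>2) powr real (K + 2)"
    by (subst powr_realpow) (auto intro!: add_pos_nonneg)
  also have "\<dots> \<le> (1 + (real a)\<^sup>2 * K1\<^sup>2) powr (2 * (K1 + 2))"
    using assms(2) by (intro powr_mono) auto
  finally show ?thesis .
qed simp

section \<open>From the growth of the complexity to infinitely many small differences\<close>

context infinite_minimal_subshift
begin

lemma card_A_pos: "1 \<le> card A"
proof -
  have "X \<noteq> {}" using inf by auto
  then have "A \<noteq> {}" using X_values by blast
  then show ?thesis using finite_A card_gt_0_iff[of A] by simp
qed

text \<open>The differences are integers: if they eventually exceeded the floor of
  \<open>K1\<close>, the lower limit would be at least that floor plus \<open>1\<close>, hence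
  larger than \<open>K1\<close>.\<close>

lemma small_difference_of_liminf:
  assumes "liminf (\<lambda>n. ereal (real (complexity X (n + 1)) - real (complexity X n))) = ereal K1"
  shows "\<exists>K. real K \<le> K1 \<and> (\<forall>N0. \<exists>N\<ge>N0. complexity X (N + 1) \<le> complexity X N + K)"
proof -
  let ?f = "\<lambda>n. real (complexity X (n + 1)) - real (complexity X n)"
  have "complexity X n \<le> complexity X (n + 1)" for n
    using complexity_step[of n] by linarith
  then have "0 \<le> liminf (\<lambda>n. ereal (?f n))"
    by (intro Liminf_bounded) auto
  then have K1: "0 \<le> K1" using assms by simp
  have "\<exists>N\<ge>N0. complexity X (N + 1) \<le> complexity X N + nat \<lfloor>K1\<rfloor>" for N0
  proof (rule ccontr)
    assume "\<not> ?thesis"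
    then have *: "complexity X N + nat \<lfloor>K1\<rfloor> < complexity X (N + 1)" if "N \<ge> N0" for N
      using that by (meson not_le)
    have "real_of_int \<lfloor>K1\<rfloor> + 1 \<le> ?f N" if "N \<ge> N0" for N
      using *[OF that] K1 by linarith
    then have "ereal (real_of_int \<lfloor>K1\<rfloor> + 1) \<le> liminf (\<lambda>n. ereal (?f n))"
      by (intro Liminf_bounded) (auto simp: eventually_sequentially)
    then have "real_of_int \<lfloor>K1\<rfloor> + 1 \<le> K1" using assms by simp
    then show False by linarith
  qed
  then show ?thesis using K1 by (intro exI[of _ "nat \<lfloor>K1\<rfloor>"]) auto
qed

text \<open>Differences eventually larger than \<open>c\<close> force growth of slope
  \<open>c + 1\<close>, which makes up for the first \<open>N0\<close> lengths and keeps the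
  quotient at least \<open>c\<close> from some length on.\<close>

lemma small_difference_of_nonsuperlinear:
  assumes "liminf (\<lambda>n. ereal (real (complexity X n) / real n)) < \<infinity>"
  shows "\<exists>K. \<forall>N0. \<exists>N\<ge>N0. complexity X (N + 1) \<le> complexity X N + K"
proof (rule ccontr)
  assume neg: "\<not> ?thesis"
  obtain c :: nat where c: "liminf (\<lambda>n. ereal (real (complexity X n) / real n)) < ereal (real c)"
    using less_PInf_Ex_of_nat assms by auto
  obtain N0 where N0: "\<And>N. N0 \<le> N \<Longrightarrow> complexity X N + c < complexity X (N + 1)"
    using neg by (meson not_le)
  have grow: "k * (c + 1) \<le> complexity X (N0 + k)" for k
  proof (induction k)
    case (Suc k)
    then show ?case using N0[of "N0 + k"] by simp
  qed simp
  \<comment> \<open>At this threshold the excess slope outweighs the initial stretch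
    \<open>N0\<close>; the \<open>+ 1\<close> keeps \<open>n\<close> positive for the
    division.\<close>
  have "real c \<le> real (complexity X n) / real n" if n: "n \<ge> N0 * (c + 1) + 1" for n
  proof -
    have "N0 \<le> N0 * (c + 1)" by simp
    then have "N0 \<le> n" using n by linarith
    then obtain k where k: "n = N0 + k" using le_Suc_ex by blast
    have "c * n \<le> k * (c + 1)" using n by (simp add: k algebra_simps)
    then have "c * n \<le> complexity X n" using grow[of k] by (simp add: k)
    then have "real c * real n \<le> real (complexity X n)" by (metis of_nat_le_iff of_nat_mult)
    then show ?thesis using n by (simp add: le_divide_eq)
  qed
  then have "ereal (real c) \<le> liminf (\<lambda>n. ereal (real (complexity X n) / real n))"
    by (intro Liminf_bounded) (auto simp: eventually_sequentially)
  then show False using c by simp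
qed

end

theorem theorem5p5:
  fixes A :: "'a set" and X :: "(int \<Rightarrow> 'a) set"
  assumes "minimal_subshift A X" and "infinite X"
  shows "(\<forall>K1::real.
            liminf (\<lambda>n. ereal (real (complexity X (n + 1)) - real (complexity X n))) = ereal K1 \<longrightarrow>
              finite_topological_rank (subtopology (full_shift A) X) shift \<and>
              real (topological_rank (subtopology (full_shift A) X) shift)
                \<le> (1 + (real (card A))\<^sup>2 * K1\<^sup>2) powr (2 * (K1 + 2))) \<and>
         (liminf (\<lambda>n. ereal (real (complexity X n) / real n)) < \<infinity> \<longrightarrow>
            finite_topological_rank (subtopology (full_shift A) X) shift)"
proof -
  interpret infinite_minimal_subshift A X
    using assms by unfold_locales
  show ?thesis
  proof (intro conjI allI impI)
    fix K1 :: real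
    assume "liminf (\<lambda>n. ereal (real (complexity X (n + 1)) - real (complexity X n))) = ereal K1"
    then obtain K where K: "real K \<le> K1" "\<And>N0. \<exists>N\<ge>N0. complexity X (N + 1) \<le> complexity X N + K"
      using small_difference_of_liminf by blast
    note rank = rank_at_most_of_complexity[OF K(2)]
    show "finite_topological_rank M shift"
      unfolding finite_topological_rank_def using rank by blast
    have "topological_rank M shift \<le> K * (\<Sum>i\<le>K + 1. card A ^ i)"
      unfolding topological_rank_def using rank by (rule Least_le)
    then have "real (topological_rank M shift) \<le> real (K * (\<Sum>i\<le>K + 1. card A ^ i))"
      by (rule of_nat_mono)
    also have "\<dots> \<le> (1 + (real (card A))\<^sup>2 * K1\<^sup>2) powr (2 * (K1 + 2))"
      using card_A_pos K(1) by (rule rank_bound)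
    finally show "real (topological_rank M shift) \<le> (1 + (real (card A))\<^sup>2 * K1\<^sup>2) powr (2 * (K1 + 2))" .
  next
    assume "liminf (\<lambda>n. ereal (real (complexity X n) / real n)) < \<infinity>"
    then obtain K where "\<And>N0. \<exists>N\<ge>N0. complexity X (N + 1) \<le> complexity X N + K"
      using small_difference_of_nonsuperlinear by blast
    then show "finite_topological_rank M shift"
      unfolding finite_topological_rank_def using rank_at_most_of_complexity by blast
  qed
qed

end
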